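(* Let $\Sigma$ be an abstract $\sigma$-algebra with measure $\mu$ and let $f,g:\mathcal{B}\to\Sigma$ be non-negative measurable functions. Then $$\int(f+g)\,d\mu=\int f\,d\mu+\int g\,d\mu.$$
   Context: An abstract $\sigma$-algebra is a Boolean algebra in which all countable joins exist. A morphism of abstract $\sigma$-algebras is a map preserving order, $0$, $1$, complements and countable joins. A measure on $\Sigma$ is a function $\mu:\Sigma\to[0,\infty]$ with $\mu(0)=0$ and $\mu(\bigvee_{i=0}^\infty a_i)=\sum_{i=0}^\infty\mu(a_i)$ whenever $a_i\wedge a_j=0$ for $i\neq j$. A $\sigma$-frame is a lattice with $0,1$, finite meets and countable joins, with finite meets distributing over countable joins. $\mathcal{B}$ denotes the universal abstract $\sigma$-algebra on the $\sigma$-frame of open subsets of $[0,\infty]$ (usual topology): every $\sigma$-frame morphism from the open sets of $[0,\infty]$ to an abstract $\sigma$-algebra $\Sigma$ extends uniquely to a morphism of abstract $\sigma$-algebras $\mathcal{B}\to\Sigma$. Open sets are regarded as elements of $\mathcal{B}$, and $[0,t]\in\mathcal{B}$ denotes the complement of $(t,\infty]$. A non-negative measurable function on $\Sigma$ is a morphism of abstract $\sigma$-algebras $f:\mathcal{B}\to\Sigma$. Write $f\le g$ if $f([0,t])\ge g([0,t])$ for every $t\in[0,\infty]$. Sum: the continuous map $+:[0,\infty]\times[0,\infty]\to[0,\infty]$ induces a morphism $+:\mathcal{B}\to\mathcal{B}\amalg\mathcal{B}$ into the categorical coproduct. It sends an open $U$ to the countable join of elements $V\otimes W:=\iota_1(V)\wedge\iota_2(W)$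 ($\iota_1,\iota_2$ the coproduct injections), taken over open rectangles $V\times W$ covering $\{(x,y):x+y\in U\}$ from inside. Then $f+g$ is the composite $\mathcal{B}\to\mathcal{B}\amalg\mathcal{B}\to\Sigma\amalg\Sigma\to\Sigma$ of $+$, $f\amalg g$ and the codiagonal. Thus $(f+g)(U)=\bigvee\{f(V)\wedge g(W)\}$ over basic open rectangles $V\times W\subseteq\{(x,y):x+y\in U\}$ from a countable base. A simple function is a morphism $f:\mathcal{B}\to\Sigma$ that factors as $f=s\circ\chi$ with morphisms of abstract $\sigma$-algebras $\chi:\mathcal{B}\to 2^{\{0,\dots,n\}}$ and $s:2^{\{0,\dots,n\}}\to\Sigma$ for some $n$. Such a $\chi$ is induced by points $x_0,\dots,x_n\in[0,\infty]$ (that is, $\chi(U)=\{i: x_i\in U\}$ for $U$ open), and one sets $\int f\,d\mu=\sum_{i=0}^n\mu(s(\{i\}))\,x_i$ with $0\cdot\infty=0$. For an arbitrary non-negative measurable $f$, $\int f\,d\mu=\sup\{\int g\,d\mu: g\le f,\ g\text{ simple}\}$. *)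

theory Defs
  imports "HOL-Analysis.Analysis"
begin

class boolean_sigma_algebra = boolean_algebra + countable_complete_lattice

text \<open>Countable meets exist in any Boolean algebra with countable joins, as complements of joins of
  complements. Only the values of \<^const>\<open>Inf\<close> and \<^const>\<open>Sup\<close> on countable sets are constrained in
  this class.\<close>

instance set :: (type) boolean_sigma_algebra ..

text \<open>In a Boolean algebra, the elements below \<open>u\<close> form a Boolean algebra with top element \<open>u\<close>
  and complement \<open>u - a\<close>; for instance \<open>{..{..n}}\<close> is the power set of \<open>{0, \<dots>, n}\<close>. The following
  are the morphisms from the elements below \<open>u\<close> to those below \<open>v\<close>; the values of \<open>h\<close> elsewhere
  are irrelevant.\<close>

definition sigma_hom_between ::
    "'a::boolean_sigma_algebra \<Rightarrow> 'b::boolean_sigma_algebra \<Rightarrow> ('a \<Rightarrow> 'b) \<Rightarrow> bool" where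
  "sigma_hom_between u v h \<longleftrightarrow>
     (\<forall>a\<le>u. h a \<le> v) \<and>
     (\<forall>a b. a \<le> b \<and> b \<le> u \<longrightarrow> h a \<le> h b) \<and>
     h bot = bot \<and> h u = v \<and>
     (\<forall>a\<le>u. h (u - a) = v - h a) \<and>
     (\<forall>a::nat \<Rightarrow> 'a. (\<forall>i. a i \<le> u) \<longrightarrow> h (SUP i. a i) = (SUP i. h (a i)))"

definition sigma_hom :: "('a::boolean_sigma_algebra \<Rightarrow> 'b::boolean_sigma_algebra) \<Rightarrow> bool" where
  "sigma_hom h \<longleftrightarrow>
     mono h \<and> h bot = bot \<and> h top = top \<and>
     (\<forall>a. h (- a) = - h a) \<and>
     (\<forall>a::nat \<Rightarrow> 'a. h (SUP i. a i) = (SUP i. h (a i)))"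

lemma sigma_hom_between_top: "sigma_hom_between top top h \<longleftrightarrow> sigma_hom h"
  by (auto simp: sigma_hom_between_def sigma_hom_def mono_def diff_eq)

lemma sigma_homI:
  fixes h :: "'a::boolean_sigma_algebra \<Rightarrow> 'b::boolean_sigma_algebra"
  assumes c: "\<And>a. h (- a) = - h a" and j: "\<And>a::nat \<Rightarrow> 'a. h (SUP i. a i) = (SUP i. h (a i))"
  shows "sigma_hom h"
proof -
  have s: "h (sup a b) = sup (h a) (h b)" for a b
  proof -
    have "range (\<lambda>n::nat. if n = 0 then a else b) = {a, b}" by auto
    moreover have "range (\<lambda>n::nat. h (if n = 0 then a else b)) = {h a, h b}" by auto
    ultimately show ?thesis using j[of "\<lambda>n. if n = 0 then a else b"] by simp
  qed
  have t: "h top = top" using s[of bot "- bot"] by (simp add: c[of bot, simplified])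
  have b: "h bot = bot" using c[of top] t by simp
  have "mono h" by (rule monoI) (metis s le_iff_sup)
  then show ?thesis using t b c j by (simp add: sigma_hom_def)
qed

lemma sigma_hom_compl: "sigma_hom h \<Longrightarrow> h (- a) = - h a"
  and sigma_hom_SUP: "sigma_hom h \<Longrightarrow> h (SUP i::nat. A i) = (SUP i. h (A i))"
  and sigma_hom_bot: "sigma_hom h \<Longrightarrow> h bot = bot"
  and sigma_hom_top: "sigma_hom h \<Longrightarrow> h top = top"
  by (auto simp: sigma_hom_def)

lemma sigma_hom_sup:
  assumes h: "sigma_hom h"
  shows "h (sup a b) = sup (h a) (h b)"
proof -
  have "range (\<lambda>n::nat. if n = 0 then a else b) = {a, b}" by auto
  moreover have "range (\<lambda>n::nat. h (if n = 0 then a else b)) = {h a, h b}" by auto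
  ultimately show ?thesis using sigma_hom_SUP[OF h, of "\<lambda>n. if n = 0 then a else b"] by simp
qed

lemma sigma_hom_inf: "sigma_hom h \<Longrightarrow> h (inf a b) = inf (h a) (h b)"
  using sigma_hom_compl[of h "sup (- a) (- b)"] by (simp add: sigma_hom_sup sigma_hom_compl)

lemma sigma_hom_ccSup:
  assumes h: "sigma_hom h" and A: "countable A"
  shows "h (Sup A) = (SUP a\<in>A. h a)"
proof (cases "A = {}")
  case False
  then have "A = range (from_nat_into A)" by (simp add: A)
  then show ?thesis using sigma_hom_SUP[OF h, of "from_nat_into A"] by (metis image_image)
qed (simp add: sigma_hom_bot[OF h])

lemma sigma_hom_id: "sigma_hom id" and sigma_hom_comp: "sigma_hom h \<Longrightarrow> sigma_hom k \<Longrightarrow> sigma_hom (h \<circ> k)"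
  by (auto intro!: sigma_homI simp: sigma_hom_compl sigma_hom_SUP)

definition sigma_measure :: "('a::boolean_sigma_algebra \<Rightarrow> ennreal) \<Rightarrow> bool" where
  "sigma_measure \<mu> \<longleftrightarrow>
     \<mu> bot = 0 \<and>
     (\<forall>a::nat \<Rightarrow> 'a. (\<forall>i j. i \<noteq> j \<longrightarrow> inf (a i) (a j) = bot) \<longrightarrow> \<mu> (SUP i. a i) = (\<Sum>i. \<mu> (a i)))"


datatype 'g sigma_term =
  Gen 'g | Bot | Compl "'g sigma_term" | Meet "'g sigma_term" "'g sigma_term"
| Join "nat \<Rightarrow> 'g sigma_term"

abbreviation Join2 :: "'g sigma_term \<Rightarrow> 'g sigma_term \<Rightarrow> 'g sigma_term" where
  "Join2 s t \<equiv> Join (\<lambda>n. if n = 0 then s else t)"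

text \<open>The relations are equations between terms; \<open>'g presented\<close> below is the Boolean
  \<open>\<sigma>\<close>-algebra with generators \<open>'g\<close> subject to them. Its universal property is
  \<open>presented_universal\<close>.\<close>

class sigma_presentation =
  fixes relations :: "('a sigma_term \<times> 'a sigma_term) set"

text \<open>The inequalities between terms that follow from the axioms of Boolean algebras with countable
  joins together with the equations in \<^const>\<open>relations\<close>.\<close>

inductive term_le :: "'g::sigma_presentation sigma_term \<Rightarrow> 'g sigma_term \<Rightarrow> bool" where
  rel1: "(s, t) \<in> relations \<Longrightarrow> term_le s t"
| rel2: "(s, t) \<in> relations \<Longrightarrow> term_le t s"
| refl: "term_le s s"
| trans: "term_le s t \<Longrightarrow> term_le t u \<Longrightarrow> term_le s u"
| bot: "term_le Bot s"
| meet1: "term_le (Meet s t) s"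
| meet2: "term_le (Meet s t) t"
| meetI: "term_le u s \<Longrightarrow> term_le u t \<Longrightarrow> term_le u (Meet s t)"
| joinI: "term_le (S n) (Join S)"
| joinE: "(\<And>n. term_le (S n) u) \<Longrightarrow> term_le (Join S) u"
| distrib: "term_le (Meet s (Join2 t u)) (Join2 (Meet s t) (Meet s u))"
| compl1: "term_le (Meet s (Compl s)) Bot"
| compl2: "term_le t (Join2 s (Compl s))"

definition term_eq :: "'g::sigma_presentation sigma_term \<Rightarrow> 'g sigma_term \<Rightarrow> bool" where
  "term_eq s t \<longleftrightarrow> term_le s t \<and> term_le t s"

lemma equivp_term_eq: "equivp term_eq"
  by (rule equivpI) (auto simp: reflp_def symp_def transp_def term_eq_def intro: term_le.intros)

quotient_type (overloaded) 'g presented = "'g::sigma_presentation sigma_term" / term_eq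
  by (rule equivp_term_eq)

lemmas term_le_meet = term_le.trans term_le.meet1 term_le.meet2 term_le.meetI term_le.compl1 term_le.bot
  term_le.refl

lemma join2I: "term_le s (Join2 s t)" "term_le t (Join2 s t)"
  using term_le.joinI[of "\<lambda>n. if n = 0 then s else t" 0]
    term_le.joinI[of "\<lambda>n. if n = 0 then s else t" 1] by auto

lemma join2E: "term_le s u \<Longrightarrow> term_le t u \<Longrightarrow> term_le (Join2 s t) u"
  by (rule term_le.joinE) simp

lemma meet_mono: "term_le s s' \<Longrightarrow> term_le t t' \<Longrightarrow> term_le (Meet s t) (Meet s' t')"
  by (rule term_le.meetI) (rule term_le.trans, rule term_le.meet1 term_le.meet2, assumption)+

lemma join2_mono: "term_le s s' \<Longrightarrow> term_le t t' \<Longrightarrow> term_le (Join2 s t) (Join2 s' t')"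
  by (rule join2E) (rule term_le.trans, assumption, rule join2I)+

lemma compl_antimono:
  assumes "term_le s t" shows "term_le (Compl t) (Compl s)"
proof -
  have "term_le (Compl t) (Meet (Compl t) (Join2 s (Compl s)))"
    by (intro term_le.meetI term_le.refl term_le.compl2)
  moreover have "term_le (Meet (Compl t) (Join2 s (Compl s)))
      (Join2 (Meet (Compl t) s) (Meet (Compl t) (Compl s)))"
    by (rule term_le.distrib)
  moreover have "term_le (Meet (Compl t) s) (Meet t (Compl t))"
    by (meson assms term_le_meet)
  then have "term_le (Join2 (Meet (Compl t) s) (Meet (Compl t) (Compl s))) (Compl s)"
    by (intro join2E) (meson term_le_meet)+
  ultimately show ?thesis by (meson term_le.trans)
qed

instantiation presented :: (sigma_presentation) boolean_sigma_algebra
begin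

lift_definition less_eq_presented :: "'a presented \<Rightarrow> 'a presented \<Rightarrow> bool" is term_le
  by (auto simp: term_eq_def intro: term_le.trans)

definition less_presented :: "'a presented \<Rightarrow> 'a presented \<Rightarrow> bool" where
  "less_presented x y \<longleftrightarrow> x \<le> y \<and> \<not> y \<le> x"

lift_definition bot_presented :: "'a presented" is Bot .

lift_definition top_presented :: "'a presented" is "Compl Bot" .

lift_definition inf_presented :: "'a presented \<Rightarrow> 'a presented \<Rightarrow> 'a presented" is Meet
  by (auto simp: term_eq_def intro: meet_mono)

lift_definition sup_presented :: "'a presented \<Rightarrow> 'a presented \<Rightarrow> 'a presented" is Join2
  unfolding term_eq_def by (blast intro: join2_mono)

lift_definition uminus_presented :: "'a presented \<Rightarrow> 'a presented" is Compl
  by (auto simp: term_eq_def compl_antimono)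

definition minus_presented :: "'a presented \<Rightarrow> 'a presented \<Rightarrow> 'a presented" where
  "minus_presented x y = inf x (- y)"

definition Sup_presented :: "'a presented set \<Rightarrow> 'a presented" where
  "Sup_presented A =
     (if A = {} then bot else abs_presented (Join (\<lambda>n. rep_presented (from_nat_into A n))))"

definition Inf_presented :: "'a presented set \<Rightarrow> 'a presented" where
  "Inf_presented A = - Sup (uminus ` A)"

lemma abs_Join_upper: "abs_presented (S n) \<le> abs_presented (Join S)"
  by (simp add: less_eq_presented.abs_eq term_le.joinI)

lemma abs_Join_least: "(\<And>n. abs_presented (S n) \<le> x) \<Longrightarrow> abs_presented (Join S) \<le> x"
  by (induction x rule: presented.abs_induct) (simp add: less_eq_presented.abs_eq term_le.joinE)

instance
proof
  fix x y z :: "'a presented" and A :: "'a presented set"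
  show "x \<le> x" by transfer (rule term_le.refl)
  show le_trans: "x \<le> y \<Longrightarrow> y \<le> z \<Longrightarrow> x \<le> z" for x y z :: "'a presented"
    by transfer (rule term_le.trans)
  show anti_sym: "x \<le> y \<Longrightarrow> y \<le> x \<Longrightarrow> x = y" for x y :: "'a presented" by transfer (simp add: term_eq_def)
  show "x < y \<longleftrightarrow> x \<le> y \<and> \<not> y \<le> x" by (rule less_presented_def)
  show "bot \<le> x" by transfer (rule term_le.bot)
  show "x \<le> top"
  proof transfer
    fix s :: "'a sigma_term"
    have "term_le s (Join2 Bot (Compl Bot))" by (rule term_le.compl2)
    moreover have "term_le (Join2 Bot (Compl Bot)) (Compl Bot)"
      by (intro join2E term_le.bot term_le.refl)
    ultimately show "term_le s (Compl Bot)" by (rule term_le.trans)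
  qed
  show infl1: "inf x y \<le> x" for x y z :: "'a presented" by transfer (rule term_le.meet1)
  show infl2: "inf x y \<le> y" for x y z :: "'a presented" by transfer (rule term_le.meet2)
  show infI: "x \<le> y \<Longrightarrow> x \<le> z \<Longrightarrow> x \<le> inf y z" for x y z :: "'a presented" by transfer (rule term_le.meetI)
  show supl1: "x \<le> sup x y" for x y z :: "'a presented" by transfer (rule join2I)
  show supl2: "y \<le> sup x y" for x y z :: "'a presented" by transfer (rule join2I)
  show supE: "y \<le> x \<Longrightarrow> z \<le> x \<Longrightarrow> sup y z \<le> x" for x y z :: "'a presented" by transfer (rule join2E)
  show "inf x (- x) = bot" by transfer (simp add: term_eq_def term_le.compl1 term_le.bot)
  show "sup x (- x) = top"
  proof transfer
    fix s :: "'a sigma_term"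
    have "term_le (Join2 s (Compl s)) (Join2 Bot (Compl Bot))" by (rule term_le.compl2)
    moreover have "term_le (Join2 Bot (Compl Bot)) (Compl Bot)"
      by (intro join2E term_le.bot term_le.refl)
    ultimately show "term_eq (Join2 s (Compl s)) (Compl Bot)"
      by (auto simp: term_eq_def intro: term_le.trans term_le.compl2)
  qed
  show "x - y = inf x (- y)" by (rule minus_presented_def)
  have up: "y \<le> Sup A" if "countable A" "y \<in> A" for y and A :: "'a presented set"
  proof -
    from from_nat_into_surj[OF that] obtain n where n: "y = from_nat_into A n" by auto
    show ?thesis
      using that(2) abs_Join_upper[of "\<lambda>n. rep_presented (from_nat_into A n)" n] n
      by (auto simp: Sup_presented_def Quotient_abs_rep[OF Quotient_presented])
  qed
  have least: "Sup A \<le> z" if "\<And>y. y \<in> A \<Longrightarrow> y \<le> z" for z and A :: "'a presented set"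
  proof (cases "A = {}")
    case True
    show ?thesis unfolding True Sup_presented_def if_P[OF HOL.refl] by transfer (rule term_le.bot)
  next
    case False
    then show ?thesis using that from_nat_into[OF False]
      by (auto simp: Sup_presented_def Quotient_abs_rep[OF Quotient_presented] intro!: abs_Join_least)
  qed
  show "countable A \<Longrightarrow> x \<in> A \<Longrightarrow> x \<le> Sup A" by (rule up)
  show "countable A \<Longrightarrow> (\<And>x. x \<in> A \<Longrightarrow> x \<le> z) \<Longrightarrow> Sup A \<le> z" by (rule least)
  have anti: "x \<le> y \<Longrightarrow> - y \<le> - x" for x y :: "'a presented" by transfer (rule compl_antimono)
  have dd: "- (- x) = x" for x :: "'a presented"
  proof transfer
    fix s :: "'a sigma_term"
    have "term_le s (Meet s (Join2 (Compl s) (Compl (Compl s))))"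
      by (intro term_le.meetI term_le.refl term_le.compl2)
    moreover have "term_le (Meet s (Join2 (Compl s) (Compl (Compl s))))
       (Join2 (Meet s (Compl s)) (Meet s (Compl (Compl s))))" by (rule term_le.distrib)
    moreover have "term_le (Join2 (Meet s (Compl s)) (Meet s (Compl (Compl s)))) (Compl (Compl s))"
      by (intro join2E) (meson term_le_meet)+
    moreover have "term_le (Compl (Compl s)) (Meet (Compl (Compl s)) (Join2 s (Compl s)))"
      by (intro term_le.meetI term_le.refl term_le.compl2)
    moreover have "term_le (Meet (Compl (Compl s)) (Join2 s (Compl s)))
       (Join2 (Meet (Compl (Compl s)) s) (Meet (Compl (Compl s)) (Compl s)))"
      by (rule term_le.distrib)
    moreover have "term_le (Meet (Compl (Compl s)) (Compl s)) (Meet (Compl s) (Compl (Compl s)))"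
      by (intro term_le.meetI term_le.meet1 term_le.meet2)
    then have "term_le (Join2 (Meet (Compl (Compl s)) s) (Meet (Compl (Compl s)) (Compl s))) s"
      by (intro join2E) (meson term_le_meet)+
    ultimately show "term_eq (Compl (Compl s)) s" unfolding term_eq_def by (meson term_le.trans)
  qed
  show "countable A \<Longrightarrow> x \<in> A \<Longrightarrow> Inf A \<le> x"
    using anti[OF up[of "uminus ` A" "- x"]] by (simp add: Inf_presented_def dd)
  show "z \<le> Inf A" if "countable A" "\<And>x. x \<in> A \<Longrightarrow> z \<le> x"
  proof -
    have "Sup (uminus ` A) \<le> - z" by (rule least) (auto intro: anti that(2))
    then show ?thesis using anti[of "Sup (uminus ` A)" "- z"] by (simp add: Inf_presented_def dd)
  qed
  show "Sup {} = (bot :: 'a presented)" by (simp add: Sup_presented_def)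
  show "Inf {} = (top :: 'a presented)"
    by (simp add: Inf_presented_def Sup_presented_def) (transfer, simp add: term_eq_def term_le.refl)
  show "sup x (inf y z) = inf (sup x y) (sup x z)"
  proof -
    have d: "inf x (sup y z) \<le> sup (inf x y) (inf x z)" for x y z :: "'a presented"
      by transfer (rule term_le.distrib)
    note [trans] = le_trans
    show ?thesis
    proof (rule anti_sym)
      have "inf (sup x y) (sup x z) \<le> sup (inf (sup x y) x) (inf (sup x y) z)" by (rule d)
      also have "\<dots> \<le> sup x (inf y z)"
      proof (rule supE)
        show "inf (sup x y) x \<le> sup x (inf y z)" by (rule le_trans[OF infl2 supl1])
        have "inf (sup x y) z \<le> sup (inf z x) (inf z y)"
          by (rule le_trans[OF infI[OF infl2 infl1] d])
        also have "\<dots> \<le> sup x (inf y z)"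
          by (rule supE[OF le_trans[OF infl2 supl1] le_trans[OF infI[OF infl2 infl1] supl2]])
        finally show "inf (sup x y) z \<le> sup x (inf y z)" .
      qed
      finally show "inf (sup x y) (sup x z) \<le> sup x (inf y z)" .
      show "sup x (inf y z) \<le> inf (sup x y) (sup x z)"
        by (rule infI[OF supE[OF supl1 le_trans[OF infl1 supl2]] supE[OF supl1 le_trans[OF infl2 supl2]]])
    qed
  qed
qed

end

lift_definition gen :: "'g::sigma_presentation \<Rightarrow> 'g presented" is Gen .

lemma bot_abs: "bot = abs_presented Bot"
  and top_abs: "top = abs_presented (Compl Bot)"
  and gen_abs: "gen g = abs_presented (Gen g)"
  and inf_abs: "inf (abs_presented s) (abs_presented t) = abs_presented (Meet s t)"
  and compl_abs: "- abs_presented s = abs_presented (Compl s)"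
  by (auto simp: bot_presented_def top_presented_def gen_def inf_presented.abs_eq
      uminus_presented.abs_eq)

lemma SUP_abs: "(SUP n. abs_presented (S n)) = abs_presented (Join S)"
  by (intro antisym ccSUP_least abs_Join_least abs_Join_upper) (auto intro: ccSUP_upper)

lemma abs_relations: "(s, t) \<in> relations \<Longrightarrow> abs_presented s = abs_presented t"
  by (auto simp: presented.abs_eq_iff term_eq_def intro: term_le.rel1 term_le.rel2)

primrec eval :: "('g \<Rightarrow> 'a::boolean_sigma_algebra) \<Rightarrow> 'g sigma_term \<Rightarrow> 'a" where
  "eval \<phi> (Gen g) = \<phi> g"
| "eval \<phi> Bot = bot"
| "eval \<phi> (Compl s) = - eval \<phi> s"
| "eval \<phi> (Meet s t) = inf (eval \<phi> s) (eval \<phi> t)"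
| "eval \<phi> (Join S) = (SUP n. eval \<phi> (S n))"

lemma eval_Join2: "eval \<phi> (Join2 s t) = sup (eval \<phi> s) (eval \<phi> t)"
proof -
  have "range (\<lambda>n::nat. eval \<phi> (if n = 0 then s else t)) = {eval \<phi> s, eval \<phi> t}" by auto
  then show ?thesis by simp
qed

lemma eval_mono:
  assumes rel: "\<And>s t. (s, t) \<in> relations \<Longrightarrow> eval \<phi> s = eval \<phi> t"
  shows "term_le s t \<Longrightarrow> eval \<phi> s \<le> eval \<phi> t"
proof (induction rule: term_le.induct)
  case (distrib s t u)
  then show ?case by (simp only: eval.simps(4) eval_Join2 inf_sup_distrib1 order_refl)
next
  case (compl2 t s)
  then show ?case by (simp only: eval.simps(3) eval_Join2 sup_compl_top top_greatest)
qed (auto simp: rel intro: order.trans le_infI1 le_infI2 ccSUP_upper ccSUP_least)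

theorem presented_universal:
  fixes \<phi> :: "'g::sigma_presentation \<Rightarrow> 'a::boolean_sigma_algebra"
  assumes rel: "\<And>s t. (s, t) \<in> relations \<Longrightarrow> eval \<phi> s = eval \<phi> t"
  shows "\<exists>!h. sigma_hom h \<and> (\<forall>g. h (gen g) = \<phi> g)"
proof (rule ex_ex1I)
  define h where "h x = eval \<phi> (rep_presented x)" for x :: "'g presented"
  have h: "h (abs_presented s) = eval \<phi> s" for s
  proof -
    have "term_eq (rep_presented (abs_presented s)) s"
      by (rule Quotient3_rep_abs[OF Quotient3_presented equivp_reflp[OF equivp_term_eq]])
    then show ?thesis 
      unfolding h_def term_eq_def using eval_mono[of \<phi>, OF rel] by (meson antisym)
  qed
  have abs: "abs_presented (rep_presented x) = x" for x :: "'g presented"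
    by (rule Quotient_abs_rep[OF Quotient_presented])
  have "sigma_hom h"
  proof (rule sigma_homI)
    fix a show "h (- a) = - h a"
      using h[of "Compl (rep_presented a)"] h[of "rep_presented a"] by (simp add: abs flip: compl_abs)
  next
    fix a :: "nat \<Rightarrow> 'g presented"
    show "h (SUP i. a i) = (SUP i. h (a i))"
      using h[of "Join (\<lambda>i. rep_presented (a i))"] by (simp add: abs h_def flip: SUP_abs)
  qed
  then show "\<exists>h. sigma_hom h \<and> (\<forall>g. h (gen g) = \<phi> g)" by (auto simp: h gen_abs)
next
  fix h k :: "'g presented \<Rightarrow> 'a"
  assume h: "sigma_hom h \<and> (\<forall>g. h (gen g) = \<phi> g)" and k: "sigma_hom k \<and> (\<forall>g. k (gen g) = \<phi> g)"
  have "h (abs_presented s) = k (abs_presented s)" for s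
    using h k by (induction s)
      (simp_all add: sigma_hom_bot sigma_hom_compl sigma_hom_inf sigma_hom_SUP
        flip: gen_abs bot_abs compl_abs inf_abs SUP_abs)
  then show "h = k" by (metis Quotient_abs_rep[OF Quotient_presented] ext)
qed


class sigma_frame = bounded_lattice + Sup +
  assumes frame_Sup_upper: "countable A \<Longrightarrow> x \<in> A \<Longrightarrow> x \<le> Sup A"
    and frame_Sup_least: "countable A \<Longrightarrow> (\<And>x. x \<in> A \<Longrightarrow> x \<le> z) \<Longrightarrow> Sup A \<le> z"
    and frame_distrib: "countable A \<Longrightarrow> inf x (Sup A) = Sup (inf x ` A)"

definition sigma_frame_hom :: "('l::sigma_frame \<Rightarrow> 'a::boolean_sigma_algebra) \<Rightarrow> bool" where
  "sigma_frame_hom \<phi> \<longleftrightarrow>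
     \<phi> bot = bot \<and> \<phi> top = top \<and> (\<forall>u v. \<phi> (inf u v) = inf (\<phi> u) (\<phi> v)) \<and>
     (\<forall>u::nat \<Rightarrow> 'l. \<phi> (SUP i. u i) = (SUP i. \<phi> (u i)))"

typedef (overloaded) 'x open_set = "{U :: 'x::topological_space set. open U}"
  morphisms pts Opn by auto

setup_lifting type_definition_open_set

instantiation open_set :: (topological_space) sigma_frame
begin

lift_definition less_eq_open_set :: "'a open_set \<Rightarrow> 'a open_set \<Rightarrow> bool" is "(\<subseteq>)" .
lift_definition less_open_set :: "'a open_set \<Rightarrow> 'a open_set \<Rightarrow> bool" is "(\<subset>)" .
lift_definition bot_open_set :: "'a open_set" is "{}" by simp
lift_definition top_open_set :: "'a open_set" is UNIV by simp
lift_definition inf_open_set :: "'a open_set \<Rightarrow> 'a open_set \<Rightarrow> 'a open_set" is "(\<inter>)" by (rule open_Int)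
lift_definition sup_open_set :: "'a open_set \<Rightarrow> 'a open_set \<Rightarrow> 'a open_set" is "(\<union>)" by (rule open_Un)
lift_definition Sup_open_set :: "'a open_set set \<Rightarrow> 'a open_set" is Union by auto

instance by standard (transfer, auto)+

end

lemma open_pts: "open (pts U)" using pts by auto

lemma pts_Sup: "pts (Sup A) = (\<Union>U\<in>A. pts U)"
  by (simp add: Sup_open_set.rep_eq)

instantiation open_set :: (topological_space) sigma_presentation
begin

definition relations_open_set :: "('a open_set sigma_term \<times> 'a open_set sigma_term) set" where
  "relations_open_set =
     {(Gen bot, Bot), (Gen top, Compl Bot)} \<union>
     {(Gen (inf U V), Meet (Gen U) (Gen V)) | U V. True} \<union>
     {(Gen (SUP i. U i), Join (\<lambda>i. Gen (U i))) | U :: nat \<Rightarrow> 'a open_set. True}"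

instance ..

end

lemma sigma_frame_hom_gen:
  "sigma_frame_hom (gen :: 'x::topological_space open_set \<Rightarrow> 'x open_set presented)"
proof -
  have r: "(s, t) \<in> relations \<Longrightarrow> abs_presented s = abs_presented t"
    for s t :: "'x open_set sigma_term" by (rule abs_relations)
  have "gen (inf U V) = inf (gen U) (gen V)" for U V :: "'x open_set"
    unfolding gen_abs inf_abs by (rule r) (auto simp: relations_open_set_def)
  moreover have "gen (SUP i. U i) = (SUP i. gen (U i))" for U :: "nat \<Rightarrow> 'x open_set"
    unfolding gen_abs SUP_abs by (rule r) (auto simp: relations_open_set_def)
  ultimately show ?thesis
    unfolding sigma_frame_hom_def
    by (auto simp: gen_abs bot_abs top_abs relations_open_set_def intro!: r)
qed

theorem open_set_universal:
  fixes \<phi> :: "'x::topological_space open_set \<Rightarrow> 'a::boolean_sigma_algebra"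
  assumes "sigma_frame_hom \<phi>"
  shows "\<exists>!h. sigma_hom h \<and> (\<forall>U. h (gen U) = \<phi> U)"
  by (rule presented_universal)
    (use assms in \<open>auto simp: relations_open_set_def sigma_frame_hom_def\<close>)

type_synonym B = "ennreal open_set presented"


instantiation sum :: (boolean_sigma_algebra, boolean_sigma_algebra) sigma_presentation
begin

text \<open>These equations say exactly that \<open>gen \<circ> Inl\<close> and \<open>gen \<circ> Inr\<close> are morphisms.\<close>

definition relations_sum :: "(('a + 'b) sigma_term \<times> ('a + 'b) sigma_term) set" where
  "relations_sum =
     {(Gen (Inl (- a)), Compl (Gen (Inl a))) | a. True} \<union>
     {(Gen (Inl (SUP i. a i)), Join (\<lambda>i. Gen (Inl (a i)))) | a :: nat \<Rightarrow> 'a. True} \<union>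
     {(Gen (Inr (- b)), Compl (Gen (Inr b))) | b. True} \<union>
     {(Gen (Inr (SUP i. b i)), Join (\<lambda>i. Gen (Inr (b i)))) | b :: nat \<Rightarrow> 'b. True}"

instance ..

end

type_synonym ('a, 'b) coprod = "('a + 'b) presented"

definition in1 :: "'a::boolean_sigma_algebra \<Rightarrow> ('a, 'b::boolean_sigma_algebra) coprod" where
  "in1 a = gen (Inl a)"

definition in2 :: "'b::boolean_sigma_algebra \<Rightarrow> ('a::boolean_sigma_algebra, 'b) coprod" where
  "in2 b = gen (Inr b)"

lemma sigma_hom_in1: "sigma_hom in1" and sigma_hom_in2: "sigma_hom in2"
  by (intro sigma_homI; auto simp: in1_def in2_def gen_abs compl_abs SUP_abs relations_sum_def
      intro!: abs_relations)+

theorem coprod_universal: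
  fixes h :: "'a::boolean_sigma_algebra \<Rightarrow> 'c::boolean_sigma_algebra"
    and k :: "'b::boolean_sigma_algebra \<Rightarrow> 'c"
  assumes "sigma_hom h" "sigma_hom k"
  shows "\<exists>!m. sigma_hom m \<and> m \<circ> in1 = h \<and> m \<circ> in2 = k"
proof -
  have "\<exists>!m. sigma_hom m \<and> (\<forall>g. m (gen g) = case_sum h k g)"
    by (rule presented_universal)
      (use assms in \<open>auto simp: relations_sum_def sigma_hom_compl sigma_hom_SUP\<close>)
  moreover have "(\<forall>g. m (gen g) = case_sum h k g) \<longleftrightarrow> m \<circ> in1 = h \<and> m \<circ> in2 = k" for m
    by (auto simp: fun_eq_iff in1_def in2_def split: sum.split)
  ultimately show ?thesis by simp
qed

definition copair :: "('a::boolean_sigma_algebra \<Rightarrow> 'c::boolean_sigma_algebra) \<Rightarrow>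
    ('b::boolean_sigma_algebra \<Rightarrow> 'c) \<Rightarrow> ('a, 'b) coprod \<Rightarrow> 'c" where
  "copair h k = (THE m. sigma_hom m \<and> m \<circ> in1 = h \<and> m \<circ> in2 = k)"

definition coprod_map :: "('a::boolean_sigma_algebra \<Rightarrow> 'c::boolean_sigma_algebra) \<Rightarrow>
    ('b::boolean_sigma_algebra \<Rightarrow> 'd::boolean_sigma_algebra) \<Rightarrow> ('a, 'b) coprod \<Rightarrow> ('c, 'd) coprod" where
  "coprod_map h k = copair (in1 \<circ> h) (in2 \<circ> k)"

definition codiagonal :: "('a::boolean_sigma_algebra, 'a) coprod \<Rightarrow> 'a" where
  "codiagonal = copair id id"

definition tensor :: "'a::boolean_sigma_algebra \<Rightarrow> 'b::boolean_sigma_algebra \<Rightarrow> ('a, 'b) coprod" where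
  "tensor a b = inf (in1 a) (in2 b)"


definition rect_union :: "('x::topological_space open_set \<times> 'y::topological_space open_set) set \<Rightarrow>
    ('x \<times> 'y) set" where
  "rect_union R = (\<Union>(V, W)\<in>R. pts V \<times> pts W)"

definition rect_join :: "('x::topological_space open_set \<times> 'y::topological_space open_set) set \<Rightarrow>
    ('x open_set presented, 'y open_set presented) coprod" where
  "rect_join R = (SUP (V, W)\<in>R. tensor (gen V) (gen W))"

text \<open>The join does not depend on the choice of the countable family \<open>R\<close> of open rectangles with
  union \<open>{(x, y). x + y \<in> U}\<close>; this is part of \<open>plus_B_ex1\<close> below.\<close>

definition plus_B :: "B \<Rightarrow> (B, B) coprod" where
  "plus_B = (THE p. sigma_hom p \<and>
     (\<forall>U R. countable R \<and> rect_union R = {(x, y). x + y \<in> pts U} \<longrightarrow> p (gen U) = rect_join R))"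

lemma inf_ccSUP:
  fixes a :: "'a::boolean_sigma_algebra"
  assumes I: "countable I"
  shows "inf a (SUP i\<in>I. b i) = (SUP i\<in>I. inf a (b i))"
proof (rule antisym)
  have "b i \<le> sup (- a) (SUP i\<in>I. inf a (b i))" if "i \<in> I" for i
    using ccSUP_upper[OF I that, of "\<lambda>i. inf a (b i)"] shunt1[of "b i" a]
    by (simp add: inf_commute)
  then have "(SUP i\<in>I. b i) \<le> sup (- a) (SUP i\<in>I. inf a (b i))" by (rule ccSUP_least[OF I])
  then show "inf a (SUP i\<in>I. b i) \<le> (SUP i\<in>I. inf a (b i))"
    using shunt1[of "SUP i\<in>I. b i" a] by (simp add: inf_commute)
  show "(SUP i\<in>I. inf a (b i)) \<le> inf a (SUP i\<in>I. b i)"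
    by (intro ccSUP_least I le_infI inf_le1 le_infI2 ccSUP_upper)
qed

lemma inf_ccSUP_ccSUP:
  fixes a :: "'i \<Rightarrow> 'a::boolean_sigma_algebra"
  assumes I: "countable I" and J: "countable J"
  shows "inf (SUP i\<in>I. a i) (SUP j\<in>J. b j) = (SUP i\<in>I. SUP j\<in>J. inf (a i) (b j))"
proof -
  have "inf (SUP i\<in>I. a i) (SUP j\<in>J. b j) = (SUP i\<in>I. inf (SUP j\<in>J. b j) (a i))"
    by (subst inf_commute) (rule inf_ccSUP[OF I])
  also have "\<dots> = (SUP i\<in>I. inf (a i) (SUP j\<in>J. b j))" by (simp only: inf_commute)
  finally show ?thesis by (simp only: inf_ccSUP[OF J])
qed

lemma gen_mono: "U \<le> V \<Longrightarrow> gen U \<le> gen V" for U V :: "'x::topological_space open_set"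
  using sigma_frame_hom_gen unfolding sigma_frame_hom_def by (metis inf.absorb_iff2 le_iff_inf)

lemma gen_Sup:
  fixes A :: "'x::topological_space open_set set"
  assumes A: "countable A"
  shows "gen (Sup A) = (SUP U\<in>A. gen U)"
proof (cases "A = {}")
  case True
  have "(Sup {} :: 'x open_set) = bot" by transfer simp
  then show ?thesis using True sigma_frame_hom_gen[where 'x='x] by (simp add: sigma_frame_hom_def)
next
  case False
  then have "A = range (from_nat_into A)" by (simp add: A)
  then show ?thesis
    using sigma_frame_hom_gen unfolding sigma_frame_hom_def by (metis image_image)
qed

lemma tensor_mono: "a \<le> a' \<Longrightarrow> b \<le> b' \<Longrightarrow> tensor a b \<le> tensor a' b'"
  unfolding tensor_def
  by (intro inf_mono) (use sigma_hom_in1 sigma_hom_in2 in \<open>auto simp: sigma_hom_def mono_def\<close>)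

lemma tensor_SUP1: "countable I \<Longrightarrow> tensor (SUP i\<in>I. a i) b = (SUP i\<in>I. tensor (a i) b)"
  by (simp add: tensor_def sigma_hom_ccSup[OF sigma_hom_in1] inf_ccSUP image_image
      inf_commute[of _ "in2 b"])

lemma tensor_SUP2: "countable I \<Longrightarrow> tensor a (SUP i\<in>I. b i) = (SUP i\<in>I. tensor a (b i))"
  by (simp add: tensor_def sigma_hom_ccSup[OF sigma_hom_in2] inf_ccSUP image_image)

lemma rect_join_upper: "countable R \<Longrightarrow> (V, W) \<in> R \<Longrightarrow> tensor (gen V) (gen W) \<le> rect_join R"
  unfolding rect_join_def by (rule ccSUP_upper2) auto

lemma tensor_le_finite_rect_join:
  assumes F: "finite F" and VW: "pts V \<times> pts W \<subseteq> rect_union F"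
  shows "tensor (gen V) (gen W) \<le> rect_join F"
proof -
  define J where "J x = {p\<in>F. x \<in> pts (fst p)}" for x
  define N where "N = J ` pts V"
  define A where "A j = Opn (\<Inter>p\<in>j. pts (fst p))" for j :: "('a open_set \<times> 'b open_set) set"
  have N: "finite N" "j \<in> N \<Longrightarrow> j \<subseteq> F" for j
    using F by (auto simp: N_def J_def intro: finite_subset[of _ "Pow F"])
  have A: "pts (A j) = (\<Inter>p\<in>j. pts (fst p))" if "j \<in> N" for j
    using N(2)[OF that] finite_subset[OF _ F] unfolding A_def
    by (subst Opn_inverse) (auto intro!: open_INT open_pts)
  have "pts V \<subseteq> pts (SUP j\<in>N. A j)"
    by (auto simp: pts_Sup A) (auto simp: N_def J_def)
  then have V: "gen V \<le> (SUP j\<in>N. gen (A j))"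
    using gen_mono[of V "SUP j\<in>N. A j"] gen_Sup[of "A ` N"] N(1)
    by (simp add: less_eq_open_set.rep_eq image_image countable_finite)
  have "tensor (gen (A j)) (gen W) \<le> rect_join F" if j: "j \<in> N" for j
  proof -
    have cj: "countable j" using N(2)[OF j] F by (meson countable_finite finite_subset)
    have "pts W \<subseteq> pts (SUP p\<in>j. snd p)"
    proof
      fix y assume y: "y \<in> pts W"
      obtain x where x: "x \<in> pts V" "j = J x" using j by (auto simp: N_def)
      then have "(x, y) \<in> rect_union F" using VW y by blast
      then obtain V' W' where "(V', W') \<in> F" "x \<in> pts V'" "y \<in> pts W'"
        unfolding rect_union_def by auto
      then show "y \<in> pts (SUP p\<in>j. snd p)" by (force simp: pts_Sup x J_def)
    qed
    then have "gen W \<le> (SUP p\<in>j. gen (snd p))"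
      using gen_mono[of W "SUP p\<in>j. snd p"] gen_Sup[of "snd ` j"] cj
      by (simp add: less_eq_open_set.rep_eq image_image)
    then have "tensor (gen (A j)) (gen W) \<le> tensor (gen (A j)) (SUP p\<in>j. gen (snd p))"
      by (intro tensor_mono order_refl)
    also have "\<dots> = (SUP p\<in>j. tensor (gen (A j)) (gen (snd p)))" by (rule tensor_SUP2[OF cj])
    also have "\<dots> \<le> rect_join F"
    proof (rule ccSUP_least[OF cj])
      fix p assume p: "p \<in> j"
      have "A j \<le> fst p" using p by (auto simp: less_eq_open_set.rep_eq A[OF j])
      then have "tensor (gen (A j)) (gen (snd p)) \<le> tensor (gen (fst p)) (gen (snd p))"
        by (intro tensor_mono gen_mono order_refl)
      also have "\<dots> \<le> rect_join F"
        using N(2)[OF j] p by (intro rect_join_upper countable_finite F) auto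
      finally show "tensor (gen (A j)) (gen (snd p)) \<le> rect_join F" .
    qed
    finally show ?thesis .
  qed
  then have "(SUP j\<in>N. tensor (gen (A j)) (gen W)) \<le> rect_join F"
    by (intro ccSUP_least countable_finite N)
  moreover have "tensor (gen V) (gen W) \<le> tensor (SUP j\<in>N. gen (A j)) (gen W)"
    by (intro tensor_mono V order_refl)
  moreover have "\<dots> = (SUP j\<in>N. tensor (gen (A j)) (gen W))"
    by (rule tensor_SUP1[OF countable_finite[OF N(1)]])
  ultimately show ?thesis by (simp only: order.trans)
qed

lemma shrink_open_set:
  fixes V :: "ennreal open_set"
  shows "\<exists>S. countable S \<and> Sup S = V \<and> (\<forall>V'\<in>S. \<exists>C. compact C \<and> pts V' \<subseteq> C \<and> C \<subseteq> pts V)"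
proof -
  obtain D :: "ennreal set set" where D: "countable D" "topological_basis D"
    using ex_countable_basis by blast
  have Dopen: "open X" if "X \<in> D" for X using D(2) that by (rule topological_basis_open)
  define S where "S = Opn ` {X\<in>D. \<exists>C. compact C \<and> X \<subseteq> C \<and> C \<subseteq> pts V}"
  have pS: "pts (Opn X) = X" if "X \<in> D" for X using Dopen[OF that] by (simp add: Opn_inverse)
  have "\<exists>X\<in>D. x \<in> X \<and> (\<exists>C. compact C \<and> X \<subseteq> C \<and> C \<subseteq> pts V)" if x: "x \<in> pts V" for x
  proof -
    have "regular_space (euclidean :: ennreal topology)"
    proof (rule compact_Hausdorff_imp_regular_space)
      show "compact_space (euclidean :: ennreal topology)"
        by (simp add: compact_space_def compact_UNIV)
      show "Hausdorff_space (euclidean :: ennreal topology)"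
        by (auto simp: Hausdorff_space_def disjnt_def dest!: hausdorff)
    qed
    moreover have "closedin euclidean (- pts V)" "x \<in> topspace euclidean - (- pts V)"
      using x open_pts[of V] by (auto simp: closed_Compl)
    ultimately obtain X Z where XZ: "open X" "open Z" "x \<in> X" "- pts V \<subseteq> Z" "disjnt X Z"
      unfolding regular_space_def by (metis open_openin)
    have "compact (- Z)" using compact_Int_closed[OF compact_UNIV, of "- Z"] XZ(2) by auto
    moreover have "X \<subseteq> - Z" "- Z \<subseteq> pts V" using XZ by (auto simp: disjnt_def)
    moreover obtain Y where "Y \<in> D" "x \<in> Y" "Y \<subseteq> X"
      using topological_basisE[OF D(2) XZ(1) XZ(3)] by blast
    ultimately show ?thesis by (intro bexI[of _ Y] conjI exI[of _ "- Z"]) auto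
  qed
  then have "pts V \<subseteq> \<Union>{X\<in>D. \<exists>C. compact C \<and> X \<subseteq> C \<and> C \<subseteq> pts V}" by fast
  moreover have "\<Union>{X\<in>D. \<exists>C. compact C \<and> X \<subseteq> C \<and> C \<subseteq> pts V} \<subseteq> pts V" by fast
  moreover have "pts (Sup S) = \<Union>{X\<in>D. \<exists>C. compact C \<and> X \<subseteq> C \<and> C \<subseteq> pts V}"
    by (simp add: pts_Sup S_def pS)
  ultimately have "pts (Sup S) = pts V" by simp
  then have "Sup S = V" by (simp add: pts_inject)
  moreover have "countable S" using D(1) by (simp add: S_def)
  moreover have "\<exists>C. compact C \<and> pts V' \<subseteq> C \<and> C \<subseteq> pts V" if "V' \<in> S" for V'
    using that by (auto simp: S_def pS)
  ultimately show ?thesis by blast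
qed

lemma tensor_le_rect_join:
  fixes V W :: "ennreal open_set"
  assumes R: "countable R" and VW: "pts V \<times> pts W \<subseteq> rect_union R"
  shows "tensor (gen V) (gen W) \<le> rect_join R"
proof -
  obtain S where S: "countable S" "Sup S = V"
    "\<forall>V'\<in>S. \<exists>C. compact C \<and> pts V' \<subseteq> C \<and> C \<subseteq> pts V" using shrink_open_set[of V] by blast
  obtain T where T: "countable T" "Sup T = W"
    "\<forall>W'\<in>T. \<exists>C. compact C \<and> pts W' \<subseteq> C \<and> C \<subseteq> pts W" using shrink_open_set[of W] by blast
  have "tensor (gen V') (gen W') \<le> rect_join R" if V': "V' \<in> S" and W': "W' \<in> T" for V' W'
  proof -
    obtain C where C: "compact C" "pts V' \<subseteq> C" "C \<subseteq> pts V" using S(3) V' by blast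
    obtain D where D: "compact D" "pts W' \<subseteq> D" "D \<subseteq> pts W" using T(3) W' by blast
    have "compact (C \<times> D)" by (intro compact_Times C D)
    moreover have "open (pts (fst p) \<times> pts (snd p))" for p :: "ennreal open_set \<times> ennreal open_set"
      by (intro open_Times open_pts)
    moreover have "C \<times> D \<subseteq> (\<Union>p\<in>R. pts (fst p) \<times> pts (snd p))"
      using C(3) D(3) VW by (fastforce simp: rect_union_def split_beta)
    ultimately obtain F where F: "F \<subseteq> R" "finite F"
      "C \<times> D \<subseteq> (\<Union>p\<in>F. pts (fst p) \<times> pts (snd p))"
      by (rule compactE_image)
    have "pts V' \<times> pts W' \<subseteq> rect_union F"
      using F(3) C(2) D(2) by (fastforce simp: rect_union_def split_beta)
    then have "tensor (gen V') (gen W') \<le> rect_join F" by (rule tensor_le_finite_rect_join[OF F(2)])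
    also have "\<dots> \<le> rect_join R" unfolding rect_join_def by (intro ccSUP_subset_mono R F) auto
    finally show ?thesis .
  qed
  then have "(SUP W'\<in>T. SUP V'\<in>S. tensor (gen V') (gen W')) \<le> rect_join R"
    by (intro ccSUP_least S T)
  then show ?thesis
    using gen_Sup[OF S(1)] gen_Sup[OF T(1)] S(1) T(1)
    by (simp add: S(2) T(2) tensor_SUP1 tensor_SUP2)
qed

lemma rect_join_mono:
  fixes R R' :: "(ennreal open_set \<times> ennreal open_set) set"
  assumes "countable R" "countable R'" "rect_union R \<subseteq> rect_union R'"
  shows "rect_join R \<le> rect_join R'"
  unfolding rect_join_def[of R]
proof (rule ccSUP_least[OF assms(1)], clarify)
  fix V W assume "(V, W) \<in> R"
  then show "tensor (gen V) (gen W) \<le> rect_join R'"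
    using assms by (intro tensor_le_rect_join) (auto simp: rect_union_def)
qed

lemma ex_rect_union:
  fixes O' :: "(ennreal \<times> ennreal) set"
  assumes "open O'"
  shows "\<exists>R. countable R \<and> rect_union R = O'"
proof -
  obtain D :: "ennreal set set" where D: "countable D" "topological_basis D"
    using ex_countable_basis by blast
  have Dopen: "open X" if "X \<in> D" for X using D(2) that by (rule topological_basis_open)
  define R where "R = (\<lambda>(X, Y). (Opn X, Opn Y)) ` {(X, Y). X \<in> D \<and> Y \<in> D \<and> X \<times> Y \<subseteq> O'}"
  have "\<exists>X\<in>D. \<exists>Y\<in>D. x \<in> X \<and> y \<in> Y \<and> X \<times> Y \<subseteq> O'" if xy: "(x, y) \<in> O'" for x y
  proof -
    obtain A B where AB: "open A" "open B" "x \<in> A" "y \<in> B" "A \<times> B \<subseteq> O'"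
      using assms xy by (auto elim: open_prod_elim)
    obtain X where X: "X \<in> D" "x \<in> X" "X \<subseteq> A" using topological_basisE[OF D(2) AB(1,3)] by blast
    obtain Y where Y: "Y \<in> D" "y \<in> Y" "Y \<subseteq> B" using topological_basisE[OF D(2) AB(2,4)] by blast
    have "X \<times> Y \<subseteq> O'" using Sigma_mono[OF X(3) Y(3)] AB(5) by (rule order.trans)
    with X Y show ?thesis by (intro bexI[of _ X] bexI[of _ Y] conjI)
  qed
  moreover have "rect_union R = (\<Union>(X, Y)\<in>{(X, Y). X \<in> D \<and> Y \<in> D \<and> X \<times> Y \<subseteq> O'}. X \<times> Y)"
    unfolding rect_union_def R_def image_image
    by (rule SUP_cong) (auto simp: Opn_inverse Dopen)
  ultimately have "z \<in> rect_union R \<longleftrightarrow> z \<in> O'" for z by (cases z) (simp, blast)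
  then have "rect_union R = O'" by blast
  moreover have "countable R"
    unfolding R_def by (intro countable_image countable_subset[OF _ countable_SIGMA[OF D(1) D(1)]]) auto
  ultimately show ?thesis by blast
qed

theorem plus_B_ex1:
  "\<exists>!p :: B \<Rightarrow> (B, B) coprod. sigma_hom p \<and>
     (\<forall>U R. countable R \<and> rect_union R = {(x, y). x + y \<in> pts U} \<longrightarrow> p (gen U) = rect_join R)"
proof -
  define P where "P U = {(x, y). x + y \<in> pts U}" for U :: "ennreal open_set"
  have oP: "open (P U)" for U
  proof -
    have "P U = (\<lambda>z. fst z + snd z) -` pts U" by (auto simp: P_def)
    moreover have "continuous_on UNIV (\<lambda>z::ennreal \<times> ennreal. fst z + snd z)"
      by (intro continuous_on_add_ennreal continuous_intros)
    ultimately show ?thesis by (simp add: open_vimage open_pts)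
  qed
  define Q where "Q U = (SOME R. countable R \<and> rect_union R = P U)" for U
  have Q: "countable (Q U)" "rect_union (Q U) = P U" for U
    unfolding Q_def using someI_ex[OF ex_rect_union[OF oP[of U]]] by auto
  define \<phi> where "\<phi> U = rect_join (Q U)" for U
  have \<phi>: "\<phi> U = rect_join R" if "countable R" "rect_union R = P U" for R U
    unfolding \<phi>_def using that Q by (intro antisym rect_join_mono) auto
  have "sigma_frame_hom \<phi>"
    unfolding sigma_frame_hom_def
  proof (intro conjI allI)
    have "\<phi> bot = rect_join {}"
      by (rule \<phi>) (auto simp: rect_union_def P_def bot_open_set.rep_eq)
    then show "\<phi> bot = bot" by (simp add: rect_join_def)
    have "\<phi> top = rect_join {(top, top)}"
      by (rule \<phi>) (auto simp: rect_union_def P_def top_open_set.rep_eq)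
    then show "\<phi> top = top"
      using sigma_frame_hom_gen[where 'x=ennreal]
      by (simp add: sigma_hom_top[OF sigma_hom_in1] sigma_hom_top[OF sigma_hom_in2] rect_join_def tensor_def sigma_frame_hom_def)
  next
    fix U U' :: "ennreal open_set"
    define I where "I = (\<lambda>((V, W), (V', W')). (inf V V', inf W W')) ` (Q U \<times> Q U')"
    have "\<phi> (inf U U') = rect_join I"
    proof (rule \<phi>)
      show "countable I" unfolding I_def by (intro countable_image countable_SIGMA Q)
      have "rect_union I = rect_union (Q U) \<inter> rect_union (Q U')"
        unfolding rect_union_def I_def by (fastforce simp: inf_open_set.rep_eq)
      then show "rect_union I = P (inf U U')"
        by (auto simp: Q P_def inf_open_set.rep_eq)
    qed
    also have "\<dots> = (SUP p\<in>Q U. SUP q\<in>Q U'. tensor (gen (inf (fst p) (fst q))) (gen (inf (snd p) (snd q))))"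
      (is "_ = ?S")
    proof (rule antisym)
      show "rect_join I \<le> ?S"
        unfolding rect_join_def I_def
        by (intro ccSUP_least countable_image countable_SIGMA Q)
          (auto intro!: ccSUP_upper2[OF Q(1)])
      have cI: "countable I" unfolding I_def by (intro countable_image countable_SIGMA Q)
      show "?S \<le> rect_join I"
        by (intro ccSUP_least Q rect_join_upper cI) (force simp: I_def)
    qed
    also have "\<dots> = (SUP p\<in>Q U. SUP q\<in>Q U'. inf (tensor (gen (fst p)) (gen (snd p)))
        (tensor (gen (fst q)) (gen (snd q))))"
      using sigma_frame_hom_gen[where 'x=ennreal]
      by (simp add: sigma_frame_hom_def tensor_def sigma_hom_inf[OF sigma_hom_in1]
          sigma_hom_inf[OF sigma_hom_in2] inf_aci)
    also have "\<dots> = inf (\<phi> U) (\<phi> U')"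
      unfolding \<phi>_def rect_join_def split_beta
      by (rule inf_ccSUP_ccSUP[OF Q(1) Q(1), symmetric])
    finally show "\<phi> (inf U U') = inf (\<phi> U) (\<phi> U')" .
  next
    fix U :: "nat \<Rightarrow> ennreal open_set"
    have "\<phi> (SUP i. U i) = rect_join (\<Union>i. Q (U i))"
    proof (rule \<phi>)
      show "countable (\<Union>i. Q (U i))" by (intro countable_UN Q) auto
      have "rect_union (\<Union>i. Q (U i)) = (\<Union>i. rect_union (Q (U i)))"
        by (auto simp: rect_union_def)
      then show "rect_union (\<Union>i. Q (U i)) = P (SUP i. U i)"
        by (auto simp: Q P_def pts_Sup)
    qed
    also have "\<dots> = (SUP i. \<phi> (U i))"
      unfolding \<phi>_def rect_join_def
      by (intro antisym ccSUP_least countable_UN Q)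
        (auto intro!: ccSUP_subset_mono countable_UN Q ccSUP_upper2[OF _ UNIV_I] ccSUP_upper2[OF Q(1)]
          ccSUP_upper2[OF countable_UN[OF _ Q(1)]])
    finally show "\<phi> (SUP i. U i) = (SUP i. \<phi> (U i))" .
  qed
  then have "\<exists>!p. sigma_hom p \<and> (\<forall>U. p (gen U) = \<phi> U)" by (rule open_set_universal)
  moreover have "(\<forall>U. p (gen U) = \<phi> U) \<longleftrightarrow>
     (\<forall>U R. countable R \<and> rect_union R = P U \<longrightarrow> p (gen U) = rect_join R)" for p
    using \<phi> Q by metis
  ultimately show ?thesis unfolding P_def by simp
qed

abbreviation measurable_fn :: "(B \<Rightarrow> 'a::boolean_sigma_algebra) \<Rightarrow> bool" where
  "measurable_fn f \<equiv> sigma_hom f"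

definition fn_plus :: "(B \<Rightarrow> 'a::boolean_sigma_algebra) \<Rightarrow> (B \<Rightarrow> 'a) \<Rightarrow> B \<Rightarrow> 'a" where
  "fn_plus f g = codiagonal \<circ> coprod_map f g \<circ> plus_B"


lemma copair:
  assumes "sigma_hom h" "sigma_hom k"
  shows "sigma_hom (copair h k)" "copair h k (in1 a) = h a" "copair h k (in2 b) = k b"
  using theI'[OF coprod_universal[OF assms], folded copair_def] by (auto simp: fun_eq_iff)

lemma plus_B:
  "sigma_hom plus_B"
  "countable R \<Longrightarrow> rect_union R = {(x, y). x + y \<in> pts U} \<Longrightarrow> plus_B (gen U) = rect_join R"
  using theI'[OF plus_B_ex1, folded plus_B_def] by auto

lemma coprod_map:
  assumes "sigma_hom f" "sigma_hom g"
  shows "sigma_hom (coprod_map f g)" "coprod_map f g (tensor a b) = tensor (f a) (g b)"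
proof -
  note c = copair[OF sigma_hom_comp[OF sigma_hom_in1 assms(1)] sigma_hom_comp[OF sigma_hom_in2 assms(2)],
      folded coprod_map_def]
  show "sigma_hom (coprod_map f g)" by (rule c)
  then show "coprod_map f g (tensor a b) = tensor (f a) (g b)"
    by (simp add: tensor_def sigma_hom_inf c)
qed

lemma codiagonal: "sigma_hom codiagonal" "codiagonal (tensor a b) = inf a b"
proof -
  note c = copair[OF sigma_hom_id sigma_hom_id, folded codiagonal_def]
  show "sigma_hom codiagonal" by (rule c)
  then show "codiagonal (tensor a b) = inf a b"
    by (simp add: tensor_def sigma_hom_inf c)
qed

theorem measurable_fn_plus:
  "measurable_fn f \<Longrightarrow> measurable_fn g \<Longrightarrow> measurable_fn (fn_plus f g)"
  unfolding fn_plus_def by (intro sigma_hom_comp codiagonal coprod_map plus_B)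

theorem fn_plus_open:
  assumes f: "measurable_fn f" and g: "measurable_fn g"
    and R: "countable R" "rect_union R = {(x, y). x + y \<in> pts U}"
  shows "fn_plus f g (gen U) = (SUP (V, W)\<in>R. inf (f (gen V)) (g (gen W)))"
proof -
  have "sigma_hom (codiagonal \<circ> coprod_map f g)"
    by (intro sigma_hom_comp codiagonal coprod_map f g)
  then show ?thesis
    using sigma_hom_ccSup[of "codiagonal \<circ> coprod_map f g" "(\<lambda>(V, W). tensor (gen V) (gen W)) ` R"] R(1)
    by (simp add: fn_plus_def plus_B(2)[OF R] rect_join_def image_image split_beta
        coprod_map(2)[OF f g] codiagonal(2))
qed

definition upto_B :: "ennreal \<Rightarrow> B" where
  "upto_B t = - gen (Opn {t<..})"

definition fn_le :: "(B \<Rightarrow> 'a::boolean_sigma_algebra) \<Rightarrow> (B \<Rightarrow> 'a) \<Rightarrow> bool" where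
  "fn_le f g \<longleftrightarrow> (\<forall>t. g (upto_B t) \<le> f (upto_B t))"

definition factors_through :: "nat \<Rightarrow> (B \<Rightarrow> nat set) \<Rightarrow> (nat set \<Rightarrow> 'a) \<Rightarrow>
    (B \<Rightarrow> 'a::boolean_sigma_algebra) \<Rightarrow> bool" where
  "factors_through n \<xi> s f \<longleftrightarrow>
     sigma_hom_between top {..n} \<xi> \<and> sigma_hom_between {..n} top s \<and> f = s \<circ> \<xi>"

definition simple_fn :: "(B \<Rightarrow> 'a::boolean_sigma_algebra) \<Rightarrow> bool" where
  "simple_fn f \<longleftrightarrow> (\<exists>n \<xi> s. factors_through n \<xi> s f)"

text \<open>The points \<open>x i\<close> for \<open>i \<le> n\<close> are determined by \<open>\<xi>\<close>, and the value \<open>v\<close> does not depend on the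
  chosen factorization. Multiplication on \<^typ>\<open>ennreal\<close> satisfies \<open>0 * \<infinity> = 0\<close>.\<close>

definition simple_fn_integral ::
    "('a::boolean_sigma_algebra \<Rightarrow> ennreal) \<Rightarrow> (B \<Rightarrow> 'a) \<Rightarrow> ennreal" where
  "simple_fn_integral \<mu> f = (THE v. \<exists>n \<xi> s x. factors_through n \<xi> s f \<and>
     (\<forall>U. \<xi> (gen U) = {i\<in>{..n}. x i \<in> pts U}) \<and> v = (\<Sum>i\<le>n. \<mu> (s {i}) * x i))"

definition fn_integral :: "('a::boolean_sigma_algebra \<Rightarrow> ennreal) \<Rightarrow> (B \<Rightarrow> 'a) \<Rightarrow> ennreal" where
  "fn_integral \<mu> f = (SUP g \<in> {g. simple_fn g \<and> fn_le g f}. simple_fn_integral \<mu> g)"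

end

theory Submission
  imports Defs
begin

text \<open>
  Everything is reduced to the decreasing family of layers \<open>f (t, \<infinity>]\<close> of a measurable function \<open>f\<close>,
  through the layer-cake formula \<open>\<integral> f d\<mu> = \<integral>\<^sup>+ \<mu> (f (t, \<infinity>]) dt\<close>, whose right hand side is an
  ordinary Lebesgue integral over the half line. The algebra \<open>\<Sigma>\<close> need not consist of sets, so there
  are no points at which functions could be compared; but order, simple approximation and addition
  are all visible on the layers, and these are elements of \<open>\<Sigma>\<close>.

  \<^item> For a simple function, given by a finite partition of the top element and a value on each
    part, the formula holds because \<open>\<integral>\<^sup>+ 1(t < x) dt = x\<close>
    (\<open>simple_fn_integral_eq_layer_integral\<close>). This also shows that the integral of a
    simple function does not depend on how the function is factored.
  \<^item> The order \<open>f \<le> g\<close> is inclusion of layers (\<open>fn_le_iff_above\<close>), so the layer integral is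
    monotone. Every measurable function is approximated from below by simple functions with finitely
    many rational values, in such a way that each layer is an increasing limit
    (\<open>simple_approximation\<close>).
    By monotone convergence on the half line (\<open>layer_integral_SUP\<close>) the layer-cake formula holds for
    all measurable functions (\<open>fn_integral_eq_layer_integral\<close>).
  \<^item> The sum of two simple functions is simple on the common refinement of their partitions, which
    gives additivity for simple functions (\<open>layer_integral_plus_step\<close>).
    Since \<open>x + y > t\<close> means \<open>x > q\<close> and \<open>y > t - q\<close> for some
    rational \<open>q\<close>, each layer of \<open>f + g\<close> is a countable join of meets of layers of \<open>f\<close> and \<open>g\<close>
    (\<open>fn_plus_above\<close>). Finite meets commute with increasing countable joins, so the layers of the
    sums of the approximations increase to those of \<open>f + g\<close>, and a second use of monotone
    convergence finishes the proof (\<open>layer_integral_plus\<close>).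
\<close>


section \<open>Measures on Boolean \<open>\<sigma>\<close>-algebras\<close>

lemma measure_bot: "sigma_measure \<mu> \<Longrightarrow> \<mu> bot = 0"
  by (simp add: sigma_measure_def)

lemma measure_finite_SUP:
  fixes P :: "'i \<Rightarrow> 'a::boolean_sigma_algebra"
  assumes \<mu>: "sigma_measure \<mu>" and I: "finite I"
    and disj: "pairwise (\<lambda>i j. inf (P i) (P j) = bot) I"
  shows "\<mu> (SUP i\<in>I. P i) = (\<Sum>i\<in>I. \<mu> (P i))"
proof -
  obtain e where e: "bij_betw e {0..<card I} I" using ex_bij_betw_nat_finite[OF I] by blast
  define a where "a k = (if k < card I then P (e k) else bot)" for k
  have eI: "e k \<in> I" if "k < card I" for k using bij_betwE[OF e] that by simp
  have "inf (a i) (a j) = bot" if "i \<noteq> j" for i j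
    using that disj eI bij_betw_imp_inj_on[OF e]
    by (auto simp: a_def pairwise_def inj_on_eq_iff)
  then have "\<mu> (SUP k. a k) = (\<Sum>k. \<mu> (a k))" using \<mu> by (simp add: sigma_measure_def)
  also have "(\<Sum>k. \<mu> (a k)) = (\<Sum>k\<in>{0..<card I}. \<mu> (a k))"
    by (rule suminf_finite) (auto simp: a_def measure_bot[OF \<mu>])
  also have "\<dots> = (\<Sum>k\<in>{0..<card I}. \<mu> (P (e k)))" by (simp add: a_def)
  also have "\<dots> = (\<Sum>i\<in>I. \<mu> (P i))" by (rule sum.reindex_bij_betw[OF e])
  also have "(SUP k. a k) = (SUP i\<in>I. P i)"
  proof (rule antisym)
    show "(SUP k. a k) \<le> (SUP i\<in>I. P i)"
      by (intro ccSUP_least) (auto simp: a_def eI intro!: ccSUP_upper countable_finite[OF I])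
    have "P i \<le> (SUP k. a k)" if "i \<in> I" for i
    proof -
      have "i \<in> e ` {0..<card I}" using that e by (simp add: bij_betw_def)
      then obtain k where "k < card I" "i = e k" by auto
      then show ?thesis using ccSUP_upper[of UNIV k a] by (simp add: a_def)
    qed
    then show "(SUP i\<in>I. P i) \<le> (SUP k. a k)" by (intro ccSUP_least countable_finite I)
  qed
  finally show ?thesis .
qed

lemma measure_mono:
  assumes \<mu>: "sigma_measure \<mu>" and ab: "a \<le> b"
  shows "\<mu> a \<le> \<mu> b"
proof -
  define P where "P c = (if c then a else b - a)" for c
  have "(SUP c\<in>UNIV. P c) = sup a (b - a)" by (simp add: P_def UNIV_bool sup_commute)
  also have "\<dots> = b" using ab by (simp add: diff_eq sup_inf_distrib1 sup_absorb2)
  finally have "\<mu> b = (\<Sum>c\<in>UNIV. \<mu> (P c))"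
    using measure_finite_SUP[OF \<mu>, of UNIV P]
    by (simp add: P_def pairwise_def diff_eq inf_commute inf_left_commute)
  then show ?thesis by (simp add: P_def UNIV_bool)
qed

lemma measure_SUP_incseq:
  fixes a :: "nat \<Rightarrow> 'a::boolean_sigma_algebra"
  assumes \<mu>: "sigma_measure \<mu>" and a: "incseq a"
  shows "\<mu> (SUP n. a n) = (SUP n. \<mu> (a n))"
proof -
  \<comment> \<open>The increments, which are disjoint, with \<open>a n\<close> as the join of the first \<open>n + 1\<close> of them.\<close>
  define b where "b n = (case n of 0 \<Rightarrow> a 0 | Suc m \<Rightarrow> a n - a m)" for n
  have ba: "b n \<le> a n" for n by (simp add: b_def diff_eq split: nat.split)
  have dj: "inf (b i) (b j) = bot" if ij: "i < j" for i j
  proof -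
    obtain m where m: "j = Suc m" "i \<le> m" using ij by (cases j) auto
    have "inf (b i) (b j) \<le> inf (a m) (- a m)"
      using order.trans[OF ba incseqD[OF a m(2)]] by (intro inf_mono) (auto simp: b_def m(1) diff_eq)
    then show ?thesis by (simp add: bot_unique)
  qed
  then have disj: "inf (b i) (b j) = bot" if "i \<noteq> j" for i j
    using that by (metis inf_commute linorder_neqE_nat)
  have a_eq: "a n = (SUP i\<in>{..n}. b i)" for n
  proof (induction n)
    case 0
    then show ?case by (simp add: b_def)
  next
    case (Suc n)
    have "(SUP i\<in>{..Suc n}. b i) = sup (b (Suc n)) (a n)"
      by (simp add: atMost_Suc ccSUP_insert Suc)
    also have "\<dots> = a (Suc n)"
      using incseqD[OF a, of n "Suc n"] by (simp add: b_def diff_eq sup_inf_distrib2 sup_absorb1)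
    finally show ?case ..
  qed
  have "\<mu> (a n) = (\<Sum>i\<le>n. \<mu> (b i))" for n
    unfolding a_eq by (rule measure_finite_SUP[OF \<mu>]) (auto simp: pairwise_def disj)
  moreover have "(SUP n. a n) = (SUP n. b n)"
  proof (rule antisym)
    show "(SUP n. a n) \<le> (SUP n. b n)"
      unfolding a_eq by (intro ccSUP_least) (auto intro: ccSUP_upper)
    show "(SUP n. b n) \<le> (SUP n. a n)"
      by (intro ccSUP_mono) (auto intro: ba)
  qed
  moreover have "\<mu> (SUP n. b n) = (\<Sum>n. \<mu> (b n))"
    using \<mu> disj by (simp add: sigma_measure_def)
  moreover have "(\<Sum>n. \<mu> (b n)) = (SUP n. \<Sum>i\<le>n. \<mu> (b i))"
    unfolding suminf_eq_SUP
  proof (rule antisym)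
    show "(SUP n. \<Sum>i<n. \<mu> (b i)) \<le> (SUP n. \<Sum>i\<le>n. \<mu> (b i))"
    proof (rule SUP_least)
      fix n
      have "(\<Sum>i<n. \<mu> (b i)) \<le> (\<Sum>i\<le>n. \<mu> (b i))" by (intro sum_mono2) auto
      also have "\<dots> \<le> (SUP n. \<Sum>i\<le>n. \<mu> (b i))" by (rule SUP_upper) simp
      finally show "(\<Sum>i<n. \<mu> (b i)) \<le> (SUP n. \<Sum>i\<le>n. \<mu> (b i))" .
    qed
    show "(SUP n. \<Sum>i\<le>n. \<mu> (b i)) \<le> (SUP n. \<Sum>i<n. \<mu> (b i))"
    proof (rule SUP_least)
      fix n
      have "(\<Sum>i\<le>n. \<mu> (b i)) = (\<Sum>i<Suc n. \<mu> (b i))" by (simp only: lessThan_Suc_atMost)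
      also have "\<dots> \<le> (SUP n. \<Sum>i<n. \<mu> (b i))" by (rule SUP_upper) simp
      finally show "(\<Sum>i\<le>n. \<mu> (b i)) \<le> (SUP n. \<Sum>i<n. \<mu> (b i))" .
    qed
  qed
  ultimately show ?thesis by simp
qed

section \<open>Layers and step functions\<close>

text \<open>The bound ranges over all extended reals, so that the bounds \<open>q\<close> and \<open>t - q\<close> that occur in the
  layers of a sum may be negative.\<close>

definition open_above :: "ereal \<Rightarrow> ennreal open_set" where
  "open_above t = Opn {x. t < enn2ereal x}"

lemma pts_above: "pts (open_above t) = {x. t < enn2ereal x}"
proof -
  have "open (enn2ereal -` {t<..})"
    by (rule open_vimage[OF _ continuous_on_enn2ereal]) simp
  then show ?thesis by (simp add: open_above_def Opn_inverse vimage_def)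
qed

definition layer_integral :: "('a::boolean_sigma_algebra \<Rightarrow> ennreal) \<Rightarrow> (B \<Rightarrow> 'a) \<Rightarrow> ennreal" where
  "layer_integral \<mu> f = (\<integral>\<^sup>+t. \<mu> (f (gen (open_above (ereal t)))) * indicator {0..} t \<partial>lborel)"

text \<open>The function \<open>f\<close> takes the value \<open>x i\<close> on the part \<open>P i\<close> of a finite partition of the top
  element. The index type is arbitrary because the common refinement of two partitions is
  indexed by pairs.\<close>

definition step_rep :: "(B \<Rightarrow> 'a::boolean_sigma_algebra) \<Rightarrow> 'i set \<Rightarrow> ('i \<Rightarrow> 'a) \<Rightarrow> ('i \<Rightarrow> ennreal) \<Rightarrow> bool" where
  "step_rep f I P x \<longleftrightarrow>
     finite I \<and> pairwise (\<lambda>i j. inf (P i) (P j) = bot) I \<and> (SUP i\<in>I. P i) = top \<and>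
     (\<forall>U. f (gen U) = (SUP i\<in>{i\<in>I. x i \<in> pts U}. P i))"

lemma step_repD:
  assumes "step_rep f I P x"
  shows "finite I" "countable I" "pairwise (\<lambda>i j. inf (P i) (P j) = bot) I" "(SUP i\<in>I. P i) = top"
    "f (gen U) = (SUP i\<in>{i\<in>I. x i \<in> pts U}. P i)"
  using assms unfolding step_rep_def by (blast intro: countable_finite)+

lemma measure_step_rep:
  assumes \<mu>: "sigma_measure \<mu>" and f: "step_rep f I P x"
  shows "\<mu> (f (gen U)) = (\<Sum>i\<in>I. \<mu> (P i) * indicator {i. x i \<in> pts U} i)"
proof -
  have fin: "finite I" and "pairwise (\<lambda>i j. inf (P i) (P j) = bot) {i\<in>I. x i \<in> pts U}"
    using f by (auto simp: step_rep_def pairwise_def)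
  then have "\<mu> (f (gen U)) = (\<Sum>i\<in>{i\<in>I. x i \<in> pts U}. \<mu> (P i))"
    using f measure_finite_SUP[OF \<mu>, of "{i\<in>I. x i \<in> pts U}" P] by (simp add: step_rep_def)
  also have "\<dots> = (\<Sum>i\<in>I. \<mu> (P i) * indicator {i. x i \<in> pts U} i)"
    using fin by (simp add: indicator_def of_bool_def sum.If_cases if_distrib Int_def cong: if_cong)
  finally show ?thesis .
qed

text \<open>This is the layer-cake formula for a single value, including \<open>x = \<infinity>\<close>; every step function is
  integrated by linearity from it.\<close>

lemma nn_integral_below:
  fixes x :: ennreal
  shows "(\<integral>\<^sup>+t. indicator {t. ereal t < enn2ereal x} t * indicator {0..} t \<partial>lborel) = x"
proof -
  have "(\<integral>\<^sup>+t. indicator {t. ereal t < enn2ereal x} t * indicator {0..} t \<partial>lborel)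
      = (\<integral>\<^sup>+t. indicator {t. 0 \<le> t \<and> ereal t < enn2ereal x} t \<partial>lborel)"
    by (intro nn_integral_cong) (auto simp: indicator_def)
  also have "\<dots> = emeasure lborel {t. 0 \<le> t \<and> ereal t < enn2ereal x}"
    by (rule nn_integral_indicator) measurable
  also have "\<dots> = x"
  proof (cases x)
    case (real r)
    then have "{t. 0 \<le> t \<and> ereal t < enn2ereal x} = {0..<r}" by (auto simp: enn2ereal_ennreal)
    then show ?thesis using real by simp
  next
    case top
    then have "{t. 0 \<le> t \<and> ereal t < enn2ereal x} = {0..}" by (auto simp: top_ereal_def)
    moreover have "emeasure lborel {0::real..} = \<infinity>"
      \<comment> \<open>A finite value \<open>r\<close> would be exceeded by the length of \<open>[0, r + 1]\<close>.\<close>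
    proof (rule ccontr)
      assume "emeasure lborel {0::real..} \<noteq> \<infinity>"
      then obtain r where r: "0 \<le> r" "emeasure lborel {0::real..} = ennreal r"
        by (cases "emeasure lborel {0::real..}") auto
      have "ennreal (r + 1) = emeasure lborel {0..r + 1}" using r by simp
      also have "\<dots> \<le> emeasure lborel {0::real..}" by (intro emeasure_mono) auto
      finally show False using r by (simp add: ennreal_le_iff)
    qed
    ultimately show ?thesis using top by simp
  qed
  finally show ?thesis .
qed

lemma measurable_below [measurable]: "{t::real. ereal t < enn2ereal x} \<in> sets borel"
  by measurable

lemma layer_integral_step_rep:
  assumes \<mu>: "sigma_measure \<mu>" and f: "step_rep f I P x"
  shows "layer_integral \<mu> f = (\<Sum>i\<in>I. \<mu> (P i) * x i)"
proof -
  have "layer_integral \<mu> f =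
      (\<integral>\<^sup>+t. (\<Sum>i\<in>I. \<mu> (P i) * (indicator {t. ereal t < enn2ereal (x i)} t * indicator {0..} t)) \<partial>lborel)"
    unfolding layer_integral_def measure_step_rep[OF \<mu> f]
    by (intro nn_integral_cong) (auto simp: pts_above sum_distrib_right mult.assoc indicator_def intro!: sum.cong)
  also have "\<dots> = (\<Sum>i\<in>I. \<integral>\<^sup>+t. \<mu> (P i) * (indicator {t. ereal t < enn2ereal (x i)} t * indicator {0..} t) \<partial>lborel)"
    by (rule nn_integral_sum) measurable
  also have "\<dots> = (\<Sum>i\<in>I. \<mu> (P i) * x i)"
    by (subst nn_integral_cmult) (measurable, simp add: nn_integral_below)
  finally show ?thesis .
qed

text \<open>The approximating functions are step functions only to make their layer functions Borel
  measurable in \<open>t\<close>; the one of \<open>f\<close> is then a supremum of measurable functions.\<close>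

lemma layer_integral_SUP:
  fixes F :: "nat \<Rightarrow> B \<Rightarrow> 'a::boolean_sigma_algebra"
  assumes \<mu>: "sigma_measure \<mu>"
    and F: "\<And>n. \<exists>(I::'i set) P x. step_rep (F n) I P x"
    and inc: "\<And>t. incseq (\<lambda>n. F n (gen (open_above (ereal t))))"
    and lim: "\<And>t. (SUP n. F n (gen (open_above (ereal t)))) = f (gen (open_above (ereal t)))"
  shows "layer_integral \<mu> f = (SUP n. layer_integral \<mu> (F n))"
proof -
  define G where "G n t = \<mu> (F n (gen (open_above (ereal t)))) * indicator {0..} t" for n t
  have "G n \<in> borel_measurable lborel" for n
  proof -
    obtain I :: "'i set" and P x where "step_rep (F n) I P x" using F by blast
    from measure_step_rep[OF \<mu> this]
    have "G n = (\<lambda>t. (\<Sum>i\<in>I. \<mu> (P i) * indicator {t. ereal t < enn2ereal (x i)} t) * indicator {0..} t)"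
      by (auto simp: G_def fun_eq_iff pts_above indicator_def)
    then show ?thesis by simp
  qed
  moreover have "incseq G"
    using inc measure_mono[OF \<mu>] by (auto simp: incseq_def le_fun_def G_def intro!: mult_right_mono)
  ultimately have "(\<integral>\<^sup>+t. (SUP n. G n t) \<partial>lborel) = (SUP n. integral\<^sup>N lborel (G n))"
    by (intro nn_integral_monotone_convergence_SUP)
  moreover have "(SUP n. G n t) = \<mu> (f (gen (open_above (ereal t)))) * indicator {0..} t" for t
    unfolding G_def
    by (simp add: measure_SUP_incseq[OF \<mu> inc, symmetric] lim SUP_mult_right_ennreal[symmetric])
  ultimately show ?thesis by (simp add: layer_integral_def G_def[symmetric])
qed

section \<open>Sums of step functions\<close>

text \<open>On the part \<open>P i \<sqinter> Q j\<close> of the common refinement the sum takes the value \<open>x i + y j\<close>: this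
  value lies in \<open>U\<close> exactly if some rectangle \<open>V \<times> W\<close> of a countable cover of
  \<open>{(x, y). x + y \<in> U}\<close> contains \<open>(x i, y j)\<close>, and the join over these rectangles is the definition
  of the sum.\<close>

lemma step_rep_plus:
  assumes f: "measurable_fn f" "step_rep f I P x" and g: "measurable_fn g" "step_rep g J Q y"
  shows "step_rep (fn_plus f g) (I \<times> J) (\<lambda>(i, j). inf (P i) (Q j)) (\<lambda>(i, j). x i + y j)"
  unfolding step_rep_def
proof (intro conjI allI)
  have IJ: "finite I" "finite J" and cIJ: "countable I" "countable J"
    and disj: "pairwise (\<lambda>i j. inf (P i) (P j) = bot) I" "pairwise (\<lambda>i j. inf (Q i) (Q j) = bot) J"
    by (rule step_repD[OF f(2)] step_repD[OF g(2)])+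
  show "finite (I \<times> J)" using IJ by simp
  have "inf (inf a b) (inf c d) = inf (inf a c) (inf b d)" for a b c d :: 'a by (simp add: inf_aci)
  then show "pairwise (\<lambda>p q. inf (case p of (i, j) \<Rightarrow> inf (P i) (Q j)) (case q of (i, j) \<Rightarrow> inf (P i) (Q j)) = bot) (I \<times> J)"
    using disj by (force simp: pairwise_def)
  have prod: "inf (SUP i\<in>I'. P i) (SUP j\<in>J'. Q j) = (SUP (i, j)\<in>I' \<times> J'. inf (P i) (Q j))"
    if "I' \<subseteq> I" "J' \<subseteq> J" for I' J'
  proof -
    have c: "countable I'" "countable J'" using that cIJ by (auto intro: countable_subset)
    show ?thesis
      unfolding inf_ccSUP_ccSUP[OF c]
      by (intro antisym ccSUP_least c countable_SIGMA)
         (auto intro!: ccSUP_upper2[OF c(1)] ccSUP_upper2[OF c(2)]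
           ccSUP_upper2[OF countable_SIGMA[OF c]] c countable_SIGMA split: prod.splits)
  qed
  show "(SUP (i, j)\<in>I \<times> J. inf (P i) (Q j)) = top"
    using prod[of I J] step_repD(4)[OF f(2)] step_repD(4)[OF g(2)] by simp
  fix U :: "ennreal open_set"
  have "open ((\<lambda>z. fst z + snd z) -` pts U :: (ennreal \<times> ennreal) set)"
    by (intro open_vimage open_pts continuous_on_add_ennreal continuous_intros)
  then obtain R where R: "countable R" "rect_union R = {(x, y). x + y \<in> pts U}"
    using ex_rect_union[of "(\<lambda>z. fst z + snd z) -` pts U"] unfolding vimage_def split_beta by blast
  have "fn_plus f g (gen U) = (SUP (V, W)\<in>R. inf (f (gen V)) (g (gen W)))"
    by (rule fn_plus_open[OF f(1) g(1) R])
  also have "\<dots> = (SUP (V, W)\<in>R. SUP (i, j)\<in>{i\<in>I. x i \<in> pts V} \<times> {j\<in>J. y j \<in> pts W}. inf (P i) (Q j))"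
    by (simp add: step_repD(5)[OF f(2)] step_repD(5)[OF g(2)] prod)
  also have "\<dots> = (SUP p\<in>{p\<in>I \<times> J. (case p of (i, j) \<Rightarrow> x i + y j) \<in> pts U}. case p of (i, j) \<Rightarrow> inf (P i) (Q j))"
    (is "?L = ?M")
  proof (rule antisym)
    have mem: "x' + y' \<in> pts U \<longleftrightarrow> (\<exists>(V, W)\<in>R. x' \<in> pts V \<and> y' \<in> pts W)" for x' y'
      using R(2) by (auto simp: rect_union_def set_eq_iff split_beta)
    have cM: "countable {p\<in>I \<times> J. (case p of (i, j) \<Rightarrow> x i + y j) \<in> pts U}"
      using IJ by (intro countable_finite) simp
    have cV: "countable ({i\<in>I. x i \<in> pts V} \<times> {j\<in>J. y j \<in> pts W})" for V W
      using IJ by (intro countable_finite) simp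
    have "inf (P i) (Q j) \<le> ?M" if "(V, W) \<in> R" "i \<in> I" "x i \<in> pts V" "j \<in> J" "y j \<in> pts W" for V W i j
    proof (rule ccSUP_upper2[OF cM])
      show "(i, j) \<in> {p\<in>I \<times> J. (case p of (i, j) \<Rightarrow> x i + y j) \<in> pts U}" using that mem by auto
    qed simp
    then show "?L \<le> ?M" by (auto intro!: ccSUP_least R(1) cV)
    have "inf (P i) (Q j) \<le> ?L" if ij: "i \<in> I" "j \<in> J" "x i + y j \<in> pts U" for i j
    proof -
      obtain V W where VW: "(V, W) \<in> R" "x i \<in> pts V" "y j \<in> pts W" using ij(3) mem by blast
      have "inf (P i) (Q j) \<le> (SUP (i, j)\<in>{i\<in>I. x i \<in> pts V} \<times> {j\<in>J. y j \<in> pts W}. inf (P i) (Q j))"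
        using ij VW by (intro ccSUP_upper2[OF cV, of "(i, j)"]) auto
      also have "\<dots> \<le> ?L" using VW by (intro ccSUP_upper2[OF R(1) VW(1)]) simp
      finally show ?thesis .
    qed
    then show "?M \<le> ?L" by (auto intro!: ccSUP_least cM)
  qed
  finally show "fn_plus f g (gen U) = \<dots>" .
qed

text \<open>Both sides are evaluated on the common refinement, over which \<open>\<mu> (P i)\<close> and \<open>\<mu> (Q j)\<close>
  decompose as row and column sums of \<open>\<mu> (P i \<sqinter> Q j)\<close>.\<close>

lemma layer_integral_plus_step:
  assumes \<mu>: "sigma_measure \<mu>"
    and f: "measurable_fn f" "step_rep f I P x" and g: "measurable_fn g" "step_rep g J Q y"
  shows "layer_integral \<mu> (fn_plus f g) = layer_integral \<mu> f + layer_integral \<mu> g"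
proof -
  have IJ: "finite I" "finite J" and cIJ: "countable I" "countable J"
    and disj: "pairwise (\<lambda>i j. inf (P i) (P j) = bot) I" "pairwise (\<lambda>i j. inf (Q i) (Q j) = bot) J"
    and top: "(SUP i\<in>I. P i) = top" "(SUP j\<in>J. Q j) = top"
    by (rule step_repD[OF f(2)] step_repD[OF g(2)])+
  have 1: "\<mu> (P i) = (\<Sum>j\<in>J. \<mu> (inf (P i) (Q j)))" for i
  proof -
    have "P i = (SUP j\<in>J. inf (P i) (Q j))" using inf_ccSUP[OF cIJ(2), of "P i" Q] top by simp
    moreover have "pairwise (\<lambda>j k. inf (inf (P i) (Q j)) (inf (P i) (Q k)) = bot) J"
      using disj(2) by (auto simp: pairwise_def inf_aci)
    ultimately show ?thesis using measure_finite_SUP[OF \<mu> IJ(2), of "\<lambda>j. inf (P i) (Q j)"] by simp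
  qed
  have 2: "\<mu> (Q j) = (\<Sum>i\<in>I. \<mu> (inf (P i) (Q j)))" for j
  proof -
    have "Q j = (SUP i\<in>I. inf (P i) (Q j))"
      using inf_ccSUP[OF cIJ(1), of "Q j" P] top by (simp add: inf_commute)
    moreover have "pairwise (\<lambda>i k. inf (inf (P i) (Q j)) (inf (P k) (Q j)) = bot) I"
      using disj(1) by (simp add: pairwise_def inf_aci) (simp add: inf_assoc[symmetric])
    ultimately show ?thesis using measure_finite_SUP[OF \<mu> IJ(1), of "\<lambda>i. inf (P i) (Q j)"] by simp
  qed
  have "layer_integral \<mu> (fn_plus f g) = (\<Sum>i\<in>I. \<Sum>j\<in>J. \<mu> (inf (P i) (Q j)) * (x i + y j))"
    by (simp add: layer_integral_step_rep[OF \<mu> step_rep_plus[OF f g]] sum.cartesian_product split_beta)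
  also have "\<dots> = (\<Sum>i\<in>I. \<Sum>j\<in>J. \<mu> (inf (P i) (Q j)) * x i) + (\<Sum>j\<in>J. \<Sum>i\<in>I. \<mu> (inf (P i) (Q j)) * y j)"
    by (subst (2) sum.swap) (simp add: distrib_left sum.distrib)
  also have "\<dots> = (\<Sum>i\<in>I. \<mu> (P i) * x i) + (\<Sum>j\<in>J. \<mu> (Q j) * y j)"
    by (simp add: 1 2 sum_distrib_right)
  finally show ?thesis
    by (simp only: layer_integral_step_rep[OF \<mu> f(2)] layer_integral_step_rep[OF \<mu> g(2)])
qed


section \<open>Simple functions are the step functions\<close>

lemma sigma_hom_betweenD:
  assumes "sigma_hom_between u v h"
  shows "a \<le> u \<Longrightarrow> h a \<le> v" "a \<le> b \<Longrightarrow> b \<le> u \<Longrightarrow> h a \<le> h b" "h bot = bot" "h u = v"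
    "a \<le> u \<Longrightarrow> h (u - a) = v - h a" "(\<And>i::nat. A i \<le> u) \<Longrightarrow> h (SUP i. A i) = (SUP i. h (A i))"
  using assms unfolding sigma_hom_between_def by simp_all

lemma sigma_hom_between_comp:
  assumes h: "sigma_hom_between u v h" and k: "sigma_hom_between v w k"
  shows "sigma_hom_between u w (k \<circ> h)"
  unfolding sigma_hom_between_def
  by (simp add: sigma_hom_betweenD[OF h] sigma_hom_betweenD[OF k])

lemma simple_fn_measurable: "simple_fn f \<Longrightarrow> measurable_fn f"
  by (auto simp: simple_fn_def factors_through_def sigma_hom_between_top[symmetric]
      intro: sigma_hom_between_comp)

text \<open>The open sets \<open>U\<close> with \<open>i \<in> \<xi> U\<close> form a completely prime filter (for countable joins). Since
  \<open>[0, \<infinity>]\<close> has a countable basis, the union of all basic open sets outside of the filter is again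
  outside of it, hence omits a point \<open>x\<close>, all of whose neighbourhoods are in the filter. Conversely, a
  member \<open>U\<close> of the filter contains \<open>x\<close>: by local compactness \<open>U\<close> has a smaller member with closure
  inside \<open>U\<close>, and if \<open>x\<close> were outside of that closure, then two disjoint open sets would be in the
  filter.\<close>

lemma finite_valued_point:
  fixes \<xi> :: "B \<Rightarrow> nat set"
  assumes \<xi>: "sigma_hom_between top {..n} \<xi>" and i: "i \<le> n"
  shows "\<exists>x. \<forall>U. i \<in> \<xi> (gen U) \<longleftrightarrow> x \<in> pts U"
proof -
  note \<xi>D = sigma_hom_betweenD[OF \<xi>]
  have join: "\<exists>U\<in>S. i \<in> \<xi> (gen U)" if S: "countable S" "i \<in> \<xi> (gen (Sup S))" for S
  proof (cases "S = {}")
    case True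
    then have "Sup S = bot" by (simp add: pts_inject[symmetric] pts_Sup bot_open_set.rep_eq)
    then have "gen (Sup S) = (bot :: B)"
      using sigma_frame_hom_gen[where 'x=ennreal] by (simp add: sigma_frame_hom_def)
    then show ?thesis using S(2) \<xi>D(3) by simp
  next
    case False
    then have r: "S = range (from_nat_into S)" by (simp add: S(1))
    then have "gen (Sup S) = (SUP k. gen (from_nat_into S k))"
      using gen_Sup[OF S(1)] by (metis image_image)
    then have "\<xi> (gen (Sup S)) = (SUP k. \<xi> (gen (from_nat_into S k)))" using \<xi>D(6) by simp
    then show ?thesis using S(2) from_nat_into[OF False] by auto
  qed
  have mono: "\<xi> (gen U) \<subseteq> \<xi> (gen V)" if "pts U \<subseteq> pts V" for U V
    using \<xi>D(2) gen_mono[of U V] that by (simp add: less_eq_open_set.rep_eq)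
  have gtop: "gen top = (top :: B)" and gbot: "gen bot = (bot :: B)"
    using sigma_frame_hom_gen[where 'x=ennreal] by (simp_all add: sigma_frame_hom_def)
  have disj: "i \<notin> \<xi> (gen V)" if UV: "pts U \<inter> pts V = {}" and U: "i \<in> \<xi> (gen U)" for U V
  proof -
    have "inf U V = bot" using UV by (simp add: pts_inject[symmetric] inf_open_set.rep_eq bot_open_set.rep_eq)
    then have "inf (gen U) (gen V) = (bot :: B)"
      using sigma_frame_hom_gen[where 'x=ennreal] by (metis sigma_frame_hom_def)
    then have "gen V \<le> top - (gen U :: B)"
      by (simp add: diff_eq inf_shunt[symmetric] inf_commute)
    then have "\<xi> (gen V) \<le> {..n} - \<xi> (gen U)" using \<xi>D(2,5) by (metis top_greatest)
    then show ?thesis using U by blast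
  qed
  obtain D :: "ennreal set set" where D: "countable D" "topological_basis D"
    using ex_countable_basis by blast
  have Dpts: "pts (Opn X) = X" if "X \<in> D" for X
    using topological_basis_open[OF D(2) that] by (simp add: Opn_inverse)
  define N where "N = Opn ` {X \<in> D. i \<notin> \<xi> (gen (Opn X))}"
  have "i \<notin> \<xi> (gen (Sup N))" using join[of N] D(1) by (auto simp: N_def)
  then have "Sup N \<noteq> top" using \<xi>D(4) i gtop by auto
  then obtain x where x: "x \<notin> pts (Sup N)"
    by (auto simp: pts_inject[symmetric] top_open_set.rep_eq)
  have in1: "i \<in> \<xi> (gen U)" if xU: "x \<in> pts U" for U
  proof -
    obtain X where X: "X \<in> D" "x \<in> X" "X \<subseteq> pts U"
      using topological_basisE[OF D(2) open_pts xU] by blast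
    then have "i \<in> \<xi> (gen (Opn X))" using x by (auto simp: N_def pts_Sup Dpts)
    then show ?thesis using mono[of "Opn X" U] X Dpts by auto
  qed
  have in2: "x \<in> pts U" if iU: "i \<in> \<xi> (gen U)" for U
  proof (rule ccontr)
    assume xU: "x \<notin> pts U"
    obtain S where S: "countable S" "Sup S = U"
      "\<forall>V\<in>S. \<exists>C. compact C \<and> pts V \<subseteq> C \<and> C \<subseteq> pts U" using shrink_open_set[of U] by blast
    then obtain V where V: "V \<in> S" "i \<in> \<xi> (gen V)" using join[of S] iU by blast
    then obtain C where C: "compact C" "pts V \<subseteq> C" "C \<subseteq> pts U" using S(3) by blast
    have "open (- C)" using C(1) by (simp add: open_Compl compact_imp_closed)
    then have p: "pts (Opn (- C)) = - C" by (simp add: Opn_inverse)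
    have "i \<notin> \<xi> (gen (Opn (- C)))" using disj[OF _ V(2)] C p by blast
    then show False using in1[of "Opn (- C)"] p xU C(3) by auto
  qed
  show ?thesis using in1 in2 by blast
qed

lemma factors_through_step_rep:
  assumes f: "factors_through n \<xi> s f" and x: "\<And>U. \<xi> (gen U) = {i\<in>{..n}. x i \<in> pts U}"
  shows "step_rep f {..n} (\<lambda>i. s {i}) x"
proof -
  have s: "sigma_hom_between {..n} top s" and fs: "f = s \<circ> \<xi>" using f by (auto simp: factors_through_def)
  note sD = sigma_hom_betweenD[OF s]
  have sX: "s X = (SUP i\<in>X. s {i})" if X: "X \<subseteq> {..n}" for X
  proof -
    define a where "a k = (if k \<in> X then {k} else {})" for k
    have cX: "countable X" by simp
    have "X = (SUP k. a k)" by (auto simp: a_def)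
    moreover have "a k \<le> {..n}" for k using X by (auto simp: a_def)
    ultimately have "s X = (SUP k. s (a k))" using sD(6)[of a] by simp
    also have "\<dots> = (SUP i\<in>X. s {i})"
    proof (rule antisym)
      show "(SUP k. s (a k)) \<le> (SUP i\<in>X. s {i})"
        using sD(3) by (intro ccSUP_least) (auto simp: a_def intro!: ccSUP_upper cX)
      show "(SUP i\<in>X. s {i}) \<le> (SUP k. s (a k))"
        by (intro ccSUP_least cX ccSUP_upper2[of UNIV]) (auto simp: a_def)
    qed
    finally show ?thesis .
  qed
  have "inf (s {i}) (s {j}) = bot" if "i \<le> n" "j \<le> n" "i \<noteq> j" for i j
  proof -
    have "s {i} \<le> s ({..n} - {j})" using that by (intro sD(2)) auto
    also have "\<dots> = - s {j}" using that by (subst sD(5)) (auto simp: diff_eq)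
    finally show ?thesis by (simp add: inf_shunt)
  qed
  moreover have "(SUP i\<in>{..n}. s {i}) = top" using sX[of "{..n}"] sD(4) by (simp only: order_refl)
  moreover have "f (gen U) = (SUP i\<in>{i\<in>{..n}. x i \<in> pts U}. s {i})" for U
    using sX[of "{i\<in>{..n}. x i \<in> pts U}"] by (simp only: fs comp_apply x) blast
  ultimately show ?thesis by (simp add: step_rep_def pairwise_def)
qed

text \<open>The layer integral is defined without a factorization, which is why the definite description
  in the integral of a simple function denotes.\<close>

lemma simple_fn_integral_eq_layer_integral:
  assumes \<mu>: "sigma_measure \<mu>" and f: "simple_fn f"
  shows "simple_fn_integral \<mu> f = layer_integral \<mu> f"
  unfolding simple_fn_integral_def
proof (rule the_equality)
  obtain n \<xi> s where F: "factors_through n \<xi> s f" using f by (auto simp: simple_fn_def)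
  then have \<xi>: "sigma_hom_between top {..n} \<xi>" by (simp add: factors_through_def)
  have "\<forall>i\<in>{..n}. \<exists>x. \<forall>U. i \<in> \<xi> (gen U) \<longleftrightarrow> x \<in> pts U" using finite_valued_point[OF \<xi>] by simp
  then obtain x where x: "\<And>i U. i \<le> n \<Longrightarrow> i \<in> \<xi> (gen U) \<longleftrightarrow> x i \<in> pts U" by (metis atMost_iff)
  have sub: "\<xi> (gen U) \<subseteq> {..n}" for U using sigma_hom_betweenD(1)[OF \<xi>] by simp
  have x': "\<xi> (gen U) = {i\<in>{..n}. x i \<in> pts U}" for U using x sub[of U] by auto
  show "\<exists>n \<xi> s x. factors_through n \<xi> s f \<and> (\<forall>U. \<xi> (gen U) = {i\<in>{..n}. x i \<in> pts U}) \<and>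
      layer_integral \<mu> f = (\<Sum>i\<le>n. \<mu> (s {i}) * x i)"
    using F x' layer_integral_step_rep[OF \<mu> factors_through_step_rep[OF F x']] by blast
next
  fix v
  assume "\<exists>n \<xi> s x. factors_through n \<xi> s f \<and> (\<forall>U. \<xi> (gen U) = {i\<in>{..n}. x i \<in> pts U}) \<and>
      v = (\<Sum>i\<le>n. \<mu> (s {i}) * x i)"
  then obtain n \<xi> s x where F: "factors_through n \<xi> s f" and x: "\<And>U. \<xi> (gen U) = {i\<in>{..n}. x i \<in> pts U}"
    and v: "v = (\<Sum>i\<le>n. \<mu> (s {i}) * x i)" by blast
  show "v = layer_integral \<mu> f"
    unfolding v by (rule layer_integral_step_rep[OF \<mu> factors_through_step_rep[OF F x], symmetric])
qed

text \<open>The points \<open>x\<close> induce the morphism \<open>\<xi>\<close> into a finite power set by the universal property of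
  the open sets, and the partition induces the morphism \<open>s\<close> out of it.\<close>

lemma simple_fn_of_partition:
  fixes P :: "'i \<Rightarrow> 'a::boolean_sigma_algebra"
  assumes I: "finite I" "I \<noteq> {}" and disj: "pairwise (\<lambda>i j. inf (P i) (P j) = bot) I"
    and top: "(SUP i\<in>I. P i) = top"
  shows "\<exists>f. simple_fn f \<and> step_rep f I P x"
proof -
  \<comment> \<open>A simple function is indexed by \<open>{0, \<dots>, n}\<close>, which has \<open>n + 1\<close> elements.\<close>
  define n where "n = card I - 1"
  have "{0..<card I} = {..n}" using I card_gt_0_iff[of I] by (auto simp: n_def)
  then obtain e where e: "bij_betw e {..n} I" using ex_bij_betw_nat_finite[OF I(1)] by auto
  have "sigma_frame_hom (\<lambda>U. {k. x (e k) \<in> pts U})"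
    by (auto simp: sigma_frame_hom_def bot_open_set.rep_eq top_open_set.rep_eq inf_open_set.rep_eq pts_Sup)
  then obtain h where h: "sigma_hom h" "\<And>U. h (gen U) = {k. x (e k) \<in> pts U}"
    using ex1_implies_ex[OF open_set_universal] by blast
  define \<xi> where "\<xi> a = h a \<inter> {..n}" for a
  have \<xi>: "sigma_hom_between top {..n} \<xi>"
    using h(1) unfolding sigma_hom_between_def \<xi>_def
    by (auto simp: sigma_hom_bot sigma_hom_top sigma_hom_compl sigma_hom_SUP diff_eq)
       (auto simp: sigma_hom_def mono_def)
  define s where "s X = (SUP k\<in>X \<inter> {..n}. P (e k))" for X
  have c: "countable (X \<inter> {..n})" for X by simp
  have smono: "s X \<le> s Y" if "X \<subseteq> Y" for X Y
    unfolding s_def by (intro ccSUP_subset_mono c) (use that in auto)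
  have stop: "s {..n} = top"
    using top bij_betw_imp_surj_on[OF e] unfolding s_def by (metis image_image Int_absorb)
  have sSUP: "s (SUP i. X i) = (SUP i. s (X i))" for X :: "nat \<Rightarrow> nat set"
  proof (rule antisym)
    show "s (SUP i. X i) \<le> (SUP i. s (X i))"
      unfolding s_def
      by (intro ccSUP_least c) (auto intro!: ccSUP_upper2[OF _ UNIV_I] ccSUP_upper2[OF c])
    show "(SUP i. s (X i)) \<le> s (SUP i. X i)"
      by (intro ccSUP_least smono) auto
  qed
  have scompl: "s ({..n} - X) = top - s X" for X
  proof -
    have "inf (s X) (s ({..n} - X)) = (SUP k\<in>X \<inter> {..n}. SUP l\<in>({..n} - X) \<inter> {..n}. inf (P (e k)) (P (e l)))"
      unfolding s_def by (rule inf_ccSUP_ccSUP[OF c c])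
    also have "\<dots> \<le> bot"
    proof (intro ccSUP_least c)
      fix k l assume "k \<in> X \<inter> {..n}" "l \<in> ({..n} - X) \<inter> {..n}"
      then have "e k \<in> I" "e l \<in> I" "e k \<noteq> e l"
        using bij_betwE[OF e] bij_betw_imp_inj_on[OF e] by (auto simp: inj_on_eq_iff)
      then show "inf (P (e k)) (P (e l)) \<le> bot" using disj by (simp add: pairwise_def)
    qed
    finally have "inf (s X) (s ({..n} - X)) = bot" by (simp add: bot_unique)
    moreover have "top \<le> sup (s X) (s ({..n} - X))"
      unfolding stop[symmetric] s_def
    proof (rule ccSUP_least[OF c])
      fix k assume k: "k \<in> {..n} \<inter> {..n}"
      show "P (e k) \<le> sup (SUP k\<in>X \<inter> {..n}. P (e k)) (SUP k\<in>({..n} - X) \<inter> {..n}. P (e k))"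
      proof (cases "k \<in> X")
        case True
        then show ?thesis using k by (intro le_supI1 ccSUP_upper[OF c]) simp
      next
        case False
        then show ?thesis using k by (intro le_supI2 ccSUP_upper[OF c]) simp
      qed
    qed
    ultimately show ?thesis using compl_unique[of "s X" "s ({..n} - X)"] by (simp add: top_unique diff_eq)
  qed
  have "sigma_hom_between {..n} top s"
    using smono stop sSUP scompl by (simp add: sigma_hom_between_def) (simp add: s_def)
  then have "simple_fn (s \<circ> \<xi>)" using \<xi> by (auto simp: simple_fn_def factors_through_def)
  moreover have "(\<lambda>k. P (e k)) ` ({k. x (e k) \<in> pts U} \<inter> {..n} \<inter> {..n}) = P ` {i\<in>I. x i \<in> pts U}" for U
    using bij_betw_imp_surj_on[OF e] by auto
  then have "step_rep (s \<circ> \<xi>) I P x"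
    using I disj top by (simp add: step_rep_def s_def \<xi>_def h(2))
  ultimately show ?thesis by blast
qed

section \<open>Approximation by simple functions\<close>

text \<open>Removing from each \<open>A d\<close> everything that lies in a later one makes the family disjoint without
  changing the joins over final segments, by induction from the largest index downwards. If \<open>A d\<close> is
  the layer of a function at \<open>d\<close>, the difference \<open>P d\<close> is where the largest element of \<open>D\<close>
  strictly below the function is \<open>d\<close>.\<close>

lemma disjointify_linorder:
  fixes A :: "'i::linorder \<Rightarrow> 'a::boolean_sigma_algebra"
  assumes D: "finite D"
  defines "P \<equiv> \<lambda>d. A d - (SUP e\<in>{e\<in>D. d < e}. A e)"
  shows "pairwise (\<lambda>i j. inf (P i) (P j) = bot) D"
    and "\<And>S. S \<subseteq> D \<Longrightarrow> (\<And>d e. d \<in> S \<Longrightarrow> e \<in> D \<Longrightarrow> d < e \<Longrightarrow> e \<in> S) \<Longrightarrow> (SUP d\<in>S. P d) = (SUP d\<in>S. A d)"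
proof -
  have c: "countable {e\<in>D. d < e}" for d using D by (intro countable_finite) simp
  have PA: "P d \<le> A d" for d by (simp add: P_def diff_eq)
  have "inf (P d) (P e) = bot" if "e \<in> D" "d < e" for d e
  proof -
    have "P e \<le> (SUP e\<in>{e\<in>D. d < e}. A e)"
      using that PA by (intro ccSUP_upper2[OF c]) auto
    moreover have "P d \<le> - (SUP e\<in>{e\<in>D. d < e}. A e)" by (simp add: P_def diff_eq)
    ultimately have "P d \<le> - P e" by (meson compl_mono order.trans)
    then show ?thesis by (simp add: inf_shunt)
  qed
  then show "pairwise (\<lambda>i j. inf (P i) (P j) = bot) D"
    unfolding pairwise_def by (metis inf_commute linorder_neqE)
  fix S assume S: "S \<subseteq> D" and up: "\<And>d e. d \<in> S \<Longrightarrow> e \<in> D \<Longrightarrow> d < e \<Longrightarrow> e \<in> S"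
  have cS: "countable S" using D S by (meson countable_finite finite_subset)
  have "A d \<le> (SUP d\<in>S. P d)" if "d \<in> S" for d
    using that
  proof (induction "card {e\<in>D. d < e}" arbitrary: d rule: less_induct)
    case less
    have "A e \<le> (SUP d\<in>S. P d)" if e: "e \<in> D" "d < e" for e
    proof (rule less.hyps)
      show "card {e'\<in>D. e < e'} < card {e\<in>D. d < e}"
        using D e by (intro psubset_card_mono) auto
      show "e \<in> S" using up less.prems e by blast
    qed
    then have "(SUP e\<in>{e\<in>D. d < e}. A e) \<le> (SUP d\<in>S. P d)" by (intro ccSUP_least c) auto
    moreover have "P d \<le> (SUP d\<in>S. P d)" by (intro ccSUP_upper cS less.prems)
    moreover have "A d \<le> sup (P d) (SUP e\<in>{e\<in>D. d < e}. A e)"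
      by (simp add: P_def diff_eq sup_inf_distrib2)
    ultimately show ?case by (meson le_supI order.trans)
  qed
  then show "(SUP d\<in>S. P d) = (SUP d\<in>S. A d)"
    by (intro antisym ccSUP_least cS) (auto intro!: ccSUP_upper2[OF cS] PA)
qed

lemma above_right_continuous:
  assumes t: "0 \<le> t"
  shows "gen (open_above (ereal t)) = (SUP q\<in>{q\<in>\<rat>. t < q}. gen (open_above (ereal q)))"
proof -
  have "x \<in> (\<Union>q\<in>{q\<in>\<rat>. t < q}. pts (open_above (ereal q)))" if x: "ereal t < enn2ereal x" for x
  proof -
    obtain r where r: "ereal t < ereal r" "ereal r < enn2ereal x"
      using ereal_dense2[OF x] by blast
    then obtain q where q: "q \<in> \<rat>" "t < q" "q < r" using Rats_dense_in_real[of t r] by auto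
    have "ereal q < enn2ereal x" using q(3) by (intro order.strict_trans[OF _ r(2)]) simp
    then show ?thesis using q by (auto simp: pts_above)
  qed
  then have "open_above (ereal t) = Sup ((\<lambda>q. open_above (ereal q)) ` {q\<in>\<rat>. t < q})"
    unfolding pts_inject[symmetric] pts_Sup
    by (auto simp: pts_above elim: order.strict_trans[rotated])
  moreover have "countable {q::real\<in>\<rat>. t < q}" by (rule countable_subset[OF _ countable_rat]) auto
  ultimately show ?thesis using gen_Sup[of "(\<lambda>q. open_above (ereal q)) ` {q\<in>\<rat>. t < q}"] by (simp add: image_image)
qed

lemma above_antimono: "s \<le> t \<Longrightarrow> gen (open_above t) \<le> gen (open_above s)"
  by (intro gen_mono) (auto simp: less_eq_open_set.rep_eq pts_above)

lemma above_negative: "t < 0 \<Longrightarrow> open_above t = top"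
  by (auto simp: pts_inject[symmetric] pts_above top_open_set.rep_eq intro: less_le_trans)

lemma fn_le_iff_above:
  assumes f: "measurable_fn f" and g: "measurable_fn g"
  shows "fn_le f g \<longleftrightarrow> (\<forall>t\<ge>0. f (gen (open_above t)) \<le> g (gen (open_above t)))"
proof -
  have "upto_B t = - gen (open_above (enn2ereal t))" for t
    by (simp add: upto_B_def open_above_def less_ennreal.rep_eq greaterThan_def)
  then have "fn_le f g \<longleftrightarrow> (\<forall>t. f (gen (open_above (enn2ereal t))) \<le> g (gen (open_above (enn2ereal t))))"
    by (simp add: fn_le_def sigma_hom_compl[OF f] sigma_hom_compl[OF g])
  also have "\<dots> \<longleftrightarrow> (\<forall>t\<ge>0. f (gen (open_above t)) \<le> g (gen (open_above t)))"
    by (metis enn2ereal_nonneg e2ennreal_enn2ereal enn2ereal_e2ennreal)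
  finally show ?thesis .
qed

text \<open>The function \<open>F n\<close> rounds \<open>f\<close> down to the first \<open>n\<close> terms of an enumeration of the positive
  rationals (the largest one strictly below the value of \<open>f\<close>), or to \<open>0\<close> if none is below. Its layer at \<open>t \<ge> 0\<close> is the join of the layers of \<open>f\<close> at those of the
  rationals beyond \<open>t\<close>, so it increases with \<open>n\<close>, and the limit is the layer
  of \<open>f\<close> by right continuity.\<close>

lemma simple_approximation:
  fixes f :: "B \<Rightarrow> 'a::boolean_sigma_algebra"
  assumes f: "measurable_fn f"
  obtains F :: "nat \<Rightarrow> B \<Rightarrow> 'a" where
    "\<And>n. simple_fn (F n)" "\<And>n. fn_le (F n) f" "\<And>n. \<exists>(I::real set) P x. step_rep (F n) I P x"
    "\<And>t. incseq (\<lambda>n. F n (gen (open_above (ereal t))))"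
    "\<And>t. (SUP n. F n (gen (open_above (ereal t)))) = f (gen (open_above (ereal t)))"
proof -
  have f_mono: "f a \<le> f b" if "a \<le> b" for a b using f that by (simp add: sigma_hom_def mono_def)
  define Q where "Q = {q::real \<in> \<rat>. 0 < q}"
  have Q: "countable Q" "Q \<noteq> {}"
    unfolding Q_def by (rule countable_subset[OF _ countable_rat]) (auto intro!: exI[of _ 1])
  define D where "D n = insert 0 (from_nat_into Q ` {..<n})" for n :: nat
  have D: "finite (D n)" "D n \<noteq> {}" for n by (simp_all add: D_def)
  have D0: "d = 0 \<or> d \<in> Q" if "d \<in> D n" for d n using that from_nat_into[OF Q(2)] by (auto simp: D_def)
  then have Dpos: "0 \<le> d" if "d \<in> D n" for d n using that by (force simp: Q_def)
  have DQ: "\<exists>n. q \<in> D n" if "q \<in> Q" for q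
    using from_nat_into_surj[OF Q(1) that] by (auto simp: D_def intro: lessI)
  have Dmono: "D m \<subseteq> D n" if "m \<le> n" for m n using that by (auto simp: D_def)
  \<comment> \<open>At the value \<open>0\<close> the layer is replaced by the top element, because the set where \<open>f\<close> is rounded
    down to \<open>0\<close> includes the set where \<open>f\<close> vanishes.\<close>
  define A where "A d = (if d = 0 then top else f (gen (open_above (ereal d))))" for d
  define L where "L n t = (SUP d\<in>{d\<in>D n. t < ereal d}. A d)" for n t
  have c: "countable {d\<in>D n. R d}" for n R using D(1) by (intro countable_finite) simp
  have "\<exists>h. simple_fn h \<and> (\<exists>P x. step_rep h (D n) P x) \<and> (\<forall>t. h (gen (open_above t)) = L n t)" for n
  proof -
    define P where "P d = A d - (SUP e\<in>{e\<in>D n. d < e}. A e)" for d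
    note dj = disjointify_linorder[where D = "D n" and A = A, OF D(1), folded P_def]
    have "top \<le> (SUP d\<in>D n. A d)" by (rule ccSUP_upper2[of _ 0]) (auto simp: D_def A_def)
    then have "(SUP d\<in>D n. P d) = top" using dj(2)[of "D n"] by (simp add: top_unique)
    then obtain h where h: "simple_fn h" "step_rep h (D n) P ennreal"
      using simple_fn_of_partition[OF D dj(1), where x = ennreal] by blast
    have "h (gen (open_above t)) = L n t" for t
    proof -
      have "h (gen (open_above t)) = (SUP d\<in>{d\<in>D n. ennreal d \<in> pts (open_above t)}. P d)" by (rule step_repD(5)[OF h(2)])
      also have "{d\<in>D n. ennreal d \<in> pts (open_above t)} = {d\<in>D n. t < ereal d}"
        by (auto simp: pts_above enn2ereal_ennreal Dpos)
      also have "(SUP d\<in>\<dots>. P d) = L n t"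
        unfolding L_def by (rule dj(2)) (auto intro: order.strict_trans)
      finally show ?thesis .
    qed
    then show ?thesis using h by blast
  qed
  then obtain F where F: "\<And>n. simple_fn (F n)" "\<And>n. \<exists>P x. step_rep (F n) (D n) P x"
    "\<And>n t. F n (gen (open_above t)) = L n t" by metis
  have below: "L n t \<le> f (gen (open_above t))" if "0 \<le> t" for n t
    unfolding L_def using that by (intro ccSUP_least c) (auto simp: A_def simp flip: zero_ereal_def intro!: f_mono above_antimono)
  have le: "fn_le (F n) f" for n
    using below by (simp add: fn_le_iff_above[OF simple_fn_measurable[OF F(1)] f] F(3))
  have inc: "incseq (\<lambda>n. L n t)" for t
    unfolding L_def incseq_def by (intro allI impI ccSUP_subset_mono c) (use Dmono in auto)
  have lim: "(SUP n. L n (ereal t)) = f (gen (open_above (ereal t)))" for t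
  proof (cases "t < 0")
    case True
    have "gen top = (top :: B)"
      using sigma_frame_hom_gen[where 'x=ennreal] by (simp add: sigma_frame_hom_def)
    then have "f (gen (open_above (ereal t))) = top" using True above_negative[of "ereal t"] by (simp add: sigma_hom_top[OF f])
    moreover have "top \<le> L 0 (ereal t)"
      unfolding L_def using True by (intro ccSUP_upper2[OF c, of 0]) (auto simp: D_def A_def)
    then have "top \<le> (SUP n. L n (ereal t))" by (intro ccSUP_upper2[of UNIV 0]) auto
    ultimately show ?thesis by (simp add: top_unique)
  next
    case False
    then have t: "0 \<le> t" by simp
    have cq: "countable {q::real\<in>\<rat>. t < q}" by (rule countable_subset[OF _ countable_rat]) auto
    have "f (gen (open_above (ereal t))) = (SUP q\<in>{q\<in>\<rat>. t < q}. f (gen (open_above (ereal q))))"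
      using sigma_hom_ccSup[OF f, of "(\<lambda>q. gen (open_above (ereal q))) ` {q\<in>\<rat>. t < q}"] cq
      by (simp add: above_right_continuous[OF t] image_image)
    also have "\<dots> \<le> (SUP n. L n (ereal t))"
    proof (intro ccSUP_least cq)
      fix q assume q: "q \<in> {q\<in>\<rat>. t < q}"
      then obtain n where "q \<in> D n" using DQ[of q] t by (auto simp: Q_def)
      then have "f (gen (open_above (ereal q))) \<le> L n (ereal t)"
        unfolding L_def using q t by (intro ccSUP_upper2[OF c, of q]) (auto simp: A_def)
      also have "\<dots> \<le> (SUP n. L n (ereal t))" by (rule ccSUP_upper) auto
      finally show "f (gen (open_above (ereal q))) \<le> (SUP n. L n (ereal t))" .
    qed
    finally show ?thesis using below t by (intro antisym ccSUP_least) auto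
  qed
  show ?thesis
  proof (rule that[of F])
    show "\<exists>(I::real set) P x. step_rep (F n) I P x" for n using F(2)[of n] by blast
  qed (simp_all add: F(1) F(3) le inc lim)
qed

section \<open>The layer-cake formula and additivity\<close>

lemma fn_integral_eq_layer_integral:
  assumes \<mu>: "sigma_measure \<mu>" and f: "measurable_fn f"
  shows "fn_integral \<mu> f = layer_integral \<mu> f"
proof (rule antisym)
  show "fn_integral \<mu> f \<le> layer_integral \<mu> f"
    unfolding fn_integral_def
  proof (rule SUP_least, clarify)
    fix g :: "B \<Rightarrow> 'a" assume g: "simple_fn g" "fn_le g f"
    then have "layer_integral \<mu> g \<le> layer_integral \<mu> f"
      unfolding layer_integral_def fn_le_iff_above[OF simple_fn_measurable[OF g(1)] f]
      by (intro nn_integral_mono) (auto simp: indicator_def intro!: measure_mono[OF \<mu>])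
    then show "simple_fn_integral \<mu> g \<le> layer_integral \<mu> f"
      by (simp add: simple_fn_integral_eq_layer_integral[OF \<mu> g(1)])
  qed
  obtain F :: "nat \<Rightarrow> B \<Rightarrow> 'a" where F: "\<And>n. simple_fn (F n)" "\<And>n. fn_le (F n) f"
    "\<And>n. \<exists>(I::real set) P x. step_rep (F n) I P x"
    "\<And>t. incseq (\<lambda>n. F n (gen (open_above (ereal t))))"
    "\<And>t. (SUP n. F n (gen (open_above (ereal t)))) = f (gen (open_above (ereal t)))"
    using simple_approximation[OF f] by blast
  have "layer_integral \<mu> f = (SUP n. simple_fn_integral \<mu> (F n))"
    using layer_integral_SUP[OF \<mu> F(3-5)] by (simp add: simple_fn_integral_eq_layer_integral[OF \<mu> F(1)])
  also have "\<dots> \<le> fn_integral \<mu> f"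
    unfolding fn_integral_def using F(1,2) by (intro SUP_least SUP_upper) simp
  finally show "layer_integral \<mu> f \<le> fn_integral \<mu> f" .
qed

text \<open>Negative \<open>q\<close> and \<open>q > t\<close> are needed for the points with \<open>a = 0\<close> or \<open>b = 0\<close>, where one of the two
  strict inequalities can only hold with a negative left hand side.\<close>

lemma ereal_less_add_iff:
  assumes "0 \<le> a" "0 \<le> b"
  shows "ereal t < a + b \<longleftrightarrow> (\<exists>q\<in>\<rat>. ereal q < a \<and> ereal (t - q) < b)"
proof -
  have *: "\<exists>q\<in>\<rat>. ereal q < a \<and> ereal (t - q) < b" if "ereal t < a + b"
  proof (cases a; cases b)
    fix r s assume "a = ereal r" "b = ereal s"
    then show ?thesis using that Rats_dense_in_real[of "t - s" r] by (auto intro!: bexI)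
  next
    fix r assume "a = ereal r" "b = \<infinity>"
    then show ?thesis using Rats_dense_in_real[of "r - 1" r] by auto
  next
    fix s assume "a = \<infinity>" "b = ereal s"
    then show ?thesis using Rats_dense_in_real[of "t - s" "t - s + 1"] by (auto intro!: bexI)
  next
    assume "a = \<infinity>" "b = \<infinity>"
    then show ?thesis by (auto intro!: bexI[of _ 0])
  qed (use assms in auto)
  have "ereal t < a + b" if "ereal q < a" "ereal (t - q) < b" for q
    using assms that by (cases a; cases b) auto
  with * show ?thesis by blast
qed

lemma fn_plus_above:
  assumes f: "measurable_fn f" and g: "measurable_fn g"
  shows "fn_plus f g (gen (open_above (ereal t))) =
    (SUP q\<in>\<rat>. inf (f (gen (open_above (ereal q)))) (g (gen (open_above (ereal (t - q))))))"
proof -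
  define R where "R = (\<lambda>q. (open_above (ereal q), open_above (ereal (t - q)))) ` \<rat>"
  have "countable R" unfolding R_def by (intro countable_image countable_rat)
  moreover have "rect_union R = {(x, y). x + y \<in> pts (open_above (ereal t))}"
    by (auto simp: rect_union_def R_def pts_above plus_ennreal.rep_eq ereal_less_add_iff)
  ultimately show ?thesis
    using fn_plus_open[OF f g, of R "open_above (ereal t)"] by (simp add: R_def image_image)
qed

text \<open>The sums of the simple approximations are step functions over the product index, so their
  integrals are known, and monotone convergence applies to them once their layers are seen to
  increase to the layers of \<open>fn_plus f g\<close>.\<close>

lemma layer_integral_plus:
  fixes f g :: "B \<Rightarrow> 'a::boolean_sigma_algebra"
  assumes \<mu>: "sigma_measure \<mu>" and f: "measurable_fn f" and g: "measurable_fn g"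
  shows "layer_integral \<mu> (fn_plus f g) = layer_integral \<mu> f + layer_integral \<mu> g"
proof -
  obtain F :: "nat \<Rightarrow> B \<Rightarrow> 'a" where F: "\<And>n. simple_fn (F n)" "\<And>n. fn_le (F n) f"
    "\<And>n. \<exists>(I::real set) P x. step_rep (F n) I P x"
    "\<And>t. incseq (\<lambda>n. F n (gen (open_above (ereal t))))"
    "\<And>t. (SUP n. F n (gen (open_above (ereal t)))) = f (gen (open_above (ereal t)))"
    using simple_approximation[OF f] by blast
  obtain G :: "nat \<Rightarrow> B \<Rightarrow> 'a" where G: "\<And>n. simple_fn (G n)" "\<And>n. fn_le (G n) g"
    "\<And>n. \<exists>(I::real set) P x. step_rep (G n) I P x"
    "\<And>t. incseq (\<lambda>n. G n (gen (open_above (ereal t))))"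
    "\<And>t. (SUP n. G n (gen (open_above (ereal t)))) = g (gen (open_above (ereal t)))"
    using simple_approximation[OF g] by blast
  note FG = simple_fn_measurable[OF F(1)] simple_fn_measurable[OF G(1)]
  define H where "H n = fn_plus (F n) (G n)" for n
  have H_above: "H n (gen (open_above (ereal t))) =
      (SUP q\<in>\<rat>. inf (F n (gen (open_above (ereal q)))) (G n (gen (open_above (ereal (t - q))))))" for n t
    unfolding H_def by (rule fn_plus_above[OF FG])
  have H_step: "\<exists>(I::(real \<times> real) set) P x. step_rep (H n) I P x" for n
    using F(3) G(3) step_rep_plus[OF FG(1) _ FG(2)] unfolding H_def by blast
  have H_sum: "layer_integral \<mu> (H n) = layer_integral \<mu> (F n) + layer_integral \<mu> (G n)" for n
    using F(3) G(3) layer_integral_plus_step[OF \<mu> FG(1) _ FG(2)] unfolding H_def by blast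
  have H_inc: "incseq (\<lambda>n. H n (gen (open_above (ereal t))))" for t
    unfolding H_above incseq_def using F(4) G(4)
    by (intro allI impI ccSUP_mono countable_rat) (fastforce simp: incseq_def intro: le_infI1 le_infI2)
  have H_lim: "(SUP n. H n (gen (open_above (ereal t)))) = fn_plus f g (gen (open_above (ereal t)))" for t
  proof -
    \<comment> \<open>For increasing sequences the double join of the meets is attained on the diagonal.\<close>
    have "inf (SUP n. a n) (SUP n. b n) = (SUP n. inf (a n) (b n))" if "incseq a" "incseq b" for a b :: "nat \<Rightarrow> 'a"
      unfolding inf_ccSUP_ccSUP[of UNIV UNIV a b, simplified]
    proof (intro antisym ccSUP_least)
      fix m n
      have "inf (a m) (b n) \<le> inf (a (max m n)) (b (max m n))"
        by (intro inf_mono incseqD[OF that(1)] incseqD[OF that(2)] max.cobounded1 max.cobounded2)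
      also have "\<dots> \<le> (SUP n. inf (a n) (b n))" by (rule ccSUP_upper) auto
      finally show "inf (a m) (b n) \<le> (SUP n. inf (a n) (b n))" .
    next
      fix n show "inf (a n) (b n) \<le> (SUP m. SUP n. inf (a m) (b n))"
        by (intro ccSUP_upper2[of UNIV n]) (auto intro: ccSUP_upper)
    qed auto
    then have "fn_plus f g (gen (open_above (ereal t))) =
        (SUP q\<in>\<rat>. SUP n. inf (F n (gen (open_above (ereal q)))) (G n (gen (open_above (ereal (t - q))))))"
      unfolding fn_plus_above[OF f g] F(5)[symmetric] G(5)[symmetric] using F(4) G(4) by simp
    also have "\<dots> = (SUP n. H n (gen (open_above (ereal t))))"
      unfolding H_above
      by (intro antisym ccSUP_least countable_rat)
        (auto intro!: ccSUP_upper2[OF countable_rat] ccSUP_upper2[OF _ UNIV_I])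
    finally show ?thesis ..
  qed
  have inc: "incseq (\<lambda>n. layer_integral \<mu> (K n))"
    if K: "\<And>t. incseq (\<lambda>n. K n (gen (open_above (ereal t))))" for K :: "nat \<Rightarrow> B \<Rightarrow> 'a"
    unfolding layer_integral_def incseq_def using K
    by (intro allI impI nn_integral_mono mult_right_mono measure_mono[OF \<mu>]) (auto simp: incseq_def)
  have "layer_integral \<mu> (fn_plus f g) = (SUP n. layer_integral \<mu> (H n))"
    by (rule layer_integral_SUP[OF \<mu> H_step H_inc H_lim])
  also have "\<dots> = (SUP n. layer_integral \<mu> (F n)) + (SUP n. layer_integral \<mu> (G n))"
    unfolding H_sum by (rule ennreal_SUP_add) (intro inc F G)+
  also have "\<dots> = layer_integral \<mu> f + layer_integral \<mu> g"
    by (simp only: layer_integral_SUP[OF \<mu> F(3-5)] layer_integral_SUP[OF \<mu> G(3-5)])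
  finally show ?thesis .
qed

theorem theorem10:
  fixes \<mu> :: "'a::boolean_sigma_algebra \<Rightarrow> ennreal"
    and f g :: "B \<Rightarrow> 'a"
  assumes "sigma_measure \<mu>"
    and "measurable_fn f"
    and "measurable_fn g"
  shows "fn_integral \<mu> (fn_plus f g) = fn_integral \<mu> f + fn_integral \<mu> g"
  using assms by (simp add: fn_integral_eq_layer_integral measurable_fn_plus layer_integral_plus)

end
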